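(* Let $n$ be a positive integer, let $I$ be an interval of $\mathbb{R}$ and let $w:I\to\mathbb{C}\setminus\{0\}$ be a smooth function with $\dot w(s)\ne 0$ for every $s\in I$. For $s\in I$ define $$l_s=\Big\{(x_1w(s),\ldots,x_nw(s))\;:\;x_1,\ldots,x_n\in\mathbb{R},\ \sum_{j=1}^n x_j^2=1\Big\}\subset\mathbb{C}^n,\qquad L=\bigcup_{s\in I}l_s\subset\mathbb{C}^n .$$ Let $H_s$ be the mean curvature vector of $l_s$ in $L$. Then $$H_s(x_1w(s),\ldots,x_nw(s))=-\frac{(n-1)\,\mathrm{Re}\,(\overline{w(s)}\,\dot w(s))}{|w(s)|^2\,|\dot w(s)|^2}\cdot\frac{\partial}{\partial s},$$ where $\partial/\partial s=(x_1\dot w(s),\ldots,x_n\dot w(s))\in T_{(x_1w(s),\ldots,x_nw(s))}L$. Consequently, if $f$ is a solution (with values in $I$) of the ordinary differential equation $$\frac{df(t)}{dt}=-\frac{(n-1)\,\mathrm{Re}\,(\overline{w(f(t))}\,\dot w(f(t)))}{|w(f(t))|^2\,|\dot w(f(t))|^2},$$ then $\{l_{f(t)}\}_t$ is a mean curvature flow in $L$.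
   Context: $\mathbb{C}^n=\mathbb{R}^{2n}$ carries the Euclidean metric and submanifolds carry the induced metrics; the dot denotes $d/ds$. $L$ is parametrized by $(x,s)\mapsto w(s)x$, $x\in S^{n-1}\subset\mathbb{R}^n$, $s\in I$ (understood as an immersed submanifold). The mean curvature vector of a submanifold $M$ of a Riemannian manifold $N$ is $\sum_j(\nabla_{e_j}e_j)^\perp$, where $\nabla$ is the Levi-Civita connection of $N$, $\{e_j\}$ is a local orthonormal frame of $TM$ and $\perp$ is the orthogonal projection to the normal bundle of $M$ in $N$. A family of submanifolds $\{M_t\}$ of $N$ is a mean curvature flow in $N$ if it evolves with velocity equal to the mean curvature vector of $M_t$ in $N$; here this means that the map $(x,t)\mapsto w(f(t))x$, $x\in S^{n-1}$, has $t$-derivative equal to the mean curvature vector of $l_{f(t)}$ in $L$ at the image point. *)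

theory Defs
  imports "HOL-Analysis.Analysis"
begin

subsection \<open>Smooth maps and tangent spaces for subsets of Euclidean space\<close>

primrec Ck_on :: "nat \<Rightarrow> 'a set \<Rightarrow> ('a::euclidean_space \<Rightarrow> 'b::real_normed_vector) \<Rightarrow> bool" where
  "Ck_on 0 = (\<lambda>U f. continuous_on U f)"
| "Ck_on (Suc k) = (\<lambda>U f. (\<forall>x\<in>U. f differentiable (at x)) \<and>
      (\<forall>i\<in>Basis. Ck_on k U (\<lambda>x. frechet_derivative f (at x) i)))"

text \<open>As usual for arbitrary subsets (in particular for manifolds with boundary), smooth means
  locally extendable to a \<open>C\<^sup>\<infinity>\<close> map on an open set of the ambient space.\<close>

definition smooth_on :: "'a set \<Rightarrow> ('a::euclidean_space \<Rightarrow> 'b::real_normed_vector) \<Rightarrow> bool" where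
  "smooth_on S f \<longleftrightarrow> (\<forall>p\<in>S. \<exists>U h. open U \<and> p \<in> U \<and> (\<forall>k. Ck_on k U h) \<and>
      (\<forall>x\<in>S \<inter> U. h x = f x))"

text \<open>Velocities of one-sided curves, so that at a boundary point of a manifold with boundary the
  velocities form a half-space; its span is the usual tangent space.\<close>

definition tangent_space :: "'a::euclidean_space set \<Rightarrow> 'a \<Rightarrow> 'a set" where
  "tangent_space N p = span {v. \<exists>c \<epsilon>. \<epsilon> > 0 \<and> c 0 = p \<and> c ` {0..<\<epsilon>} \<subseteq> N \<and>
      (c has_vector_derivative v) (at (0::real) within {0..<\<epsilon>})}"

text \<open>The differential of a map on \<open>N\<close>. It is only meaningful on vectors of
  \<open>tangent_space N p\<close>: there all derivatives of \<open>f\<close> at \<open>p\<close> within \<open>N\<close> agree.\<close>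

definition differential ::
  "'a::euclidean_space set \<Rightarrow> ('a \<Rightarrow> 'b::real_normed_vector) \<Rightarrow> 'a \<Rightarrow> 'a \<Rightarrow> 'b" where
  "differential N f p v = frechet_derivative f (at p within N) v"

definition vector_fields :: "'a::euclidean_space set \<Rightarrow> ('a \<Rightarrow> 'a) set" where
  "vector_fields N = {X. smooth_on N X \<and> (\<forall>p\<in>N. X p \<in> tangent_space N p)}"

definition lie_bracket ::
  "'a::euclidean_space set \<Rightarrow> ('a \<Rightarrow> 'a) \<Rightarrow> ('a \<Rightarrow> 'a) \<Rightarrow> 'a \<Rightarrow> 'a" where
  "lie_bracket N X Y p = differential N Y p (X p) - differential N X p (Y p)"


subsection \<open>Levi-Civita connection and mean curvature vector\<close>

text \<open>A Riemannian metric on \<open>N\<close> is given as \<open>g p u v\<close> for \<open>u\<close>, \<open>v\<close> in \<open>tangent_space N p\<close>.\<close>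

definition induced_metric ::
  "'a::euclidean_space set \<Rightarrow> ('a \<Rightarrow> 'b::euclidean_space) \<Rightarrow> 'a \<Rightarrow> 'a \<Rightarrow> 'a \<Rightarrow> real" where
  "induced_metric N F p u v = differential N F p u \<bullet> differential N F p v"

definition affine_connection ::
  "'a::euclidean_space set \<Rightarrow> (('a \<Rightarrow> 'a) \<Rightarrow> ('a \<Rightarrow> 'a) \<Rightarrow> 'a \<Rightarrow> 'a) \<Rightarrow> bool" where
  "affine_connection N nabla \<longleftrightarrow>
     (\<forall>X\<in>vector_fields N. \<forall>Y\<in>vector_fields N. nabla X Y \<in> vector_fields N) \<and>
     (\<forall>X\<in>vector_fields N. \<forall>X'\<in>vector_fields N. \<forall>Y\<in>vector_fields N. \<forall>p\<in>N.
        nabla (\<lambda>q. X q + X' q) Y p = nabla X Y p + nabla X' Y p) \<and>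
     (\<forall>X\<in>vector_fields N. \<forall>Y\<in>vector_fields N. \<forall>Y'\<in>vector_fields N. \<forall>p\<in>N.
        nabla X (\<lambda>q. Y q + Y' q) p = nabla X Y p + nabla X Y' p) \<and>
     (\<forall>\<phi>::'a \<Rightarrow> real. smooth_on N \<phi> \<longrightarrow>
        (\<forall>X\<in>vector_fields N. \<forall>Y\<in>vector_fields N. \<forall>p\<in>N.
           nabla (\<lambda>q. \<phi> q *\<^sub>R X q) Y p = \<phi> p *\<^sub>R nabla X Y p \<and>
           nabla X (\<lambda>q. \<phi> q *\<^sub>R Y q) p =
             differential N \<phi> p (X p) *\<^sub>R Y p + \<phi> p *\<^sub>R nabla X Y p))"

definition levi_civita ::
  "'a::euclidean_space set \<Rightarrow> ('a \<Rightarrow> 'a \<Rightarrow> 'a \<Rightarrow> real) \<Rightarrow>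
   (('a \<Rightarrow> 'a) \<Rightarrow> ('a \<Rightarrow> 'a) \<Rightarrow> 'a \<Rightarrow> 'a) \<Rightarrow> bool" where
  "levi_civita N g nabla \<longleftrightarrow> affine_connection N nabla \<and>
     (\<forall>X\<in>vector_fields N. \<forall>Y\<in>vector_fields N. \<forall>Z\<in>vector_fields N. \<forall>p\<in>N.
        differential N (\<lambda>q. g q (Y q) (Z q)) p (X p) =
          g p (nabla X Y p) (Z p) + g p (Y p) (nabla X Z p)) \<and>
     (\<forall>X\<in>vector_fields N. \<forall>Y\<in>vector_fields N. \<forall>p\<in>N.
        nabla X Y p - nabla Y X p = lie_bracket N X Y p)"

definition normal_part ::
  "'a::euclidean_space set \<Rightarrow> ('a \<Rightarrow> 'a \<Rightarrow> 'a \<Rightarrow> real) \<Rightarrow> 'a set \<Rightarrow> 'a \<Rightarrow> 'a \<Rightarrow> 'a" where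
  "normal_part N g M p v =
     (THE u. u \<in> tangent_space N p \<and> v - u \<in> tangent_space M p \<and>
        (\<forall>z\<in>tangent_space M p. g p u z = 0))"

definition orthonormal_frame_on ::
  "('a::euclidean_space \<Rightarrow> 'a \<Rightarrow> 'a \<Rightarrow> real) \<Rightarrow> 'a set \<Rightarrow> 'a set \<Rightarrow> nat \<Rightarrow> (nat \<Rightarrow> 'a \<Rightarrow> 'a) \<Rightarrow> bool" where
  "orthonormal_frame_on g M U m e \<longleftrightarrow> (\<forall>q\<in>M \<inter> U.
     span ((\<lambda>j. e j q) ` {..<m}) = tangent_space M q \<and>
     (\<forall>i<m. \<forall>j<m. g q (e i q) (e j q) = (if i = j then 1 else 0)))"

text \<open>Mean curvature vector at \<open>p\<close> of the submanifold \<open>M\<close> of the Riemannian manifold \<open>(N, g)\<close>.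
  The frame fields, which only matter along \<open>M\<close>, are given through extensions to vector fields on
  the neighbourhood \<open>N \<inter> U\<close> of \<open>p\<close> in \<open>N\<close>, so that \<open>nabla\<close>, the Levi-Civita connection of the
  open submanifold \<open>N \<inter> U\<close>, can be applied to them.\<close>

definition mean_curvature_vector ::
  "'a::euclidean_space set \<Rightarrow> ('a \<Rightarrow> 'a \<Rightarrow> 'a \<Rightarrow> real) \<Rightarrow> 'a set \<Rightarrow> 'a \<Rightarrow> 'a" where
  "mean_curvature_vector N g M p =
     (THE H. \<exists>U nabla m e. open U \<and> p \<in> U \<and> levi_civita (N \<inter> U) g nabla \<and>
        (\<forall>j<m. e j \<in> vector_fields (N \<inter> U)) \<and> orthonormal_frame_on g M U m e \<and>
        H = (\<Sum>j<m. normal_part N g M p (nabla (e j) (e j) p)))"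


subsection \<open>The submanifold \<open>L\<close> and its leaves \<open>l\<^sub>s\<close>\<close>

definition leaf :: "(real \<Rightarrow> complex) \<Rightarrow> real \<Rightarrow> (complex ^ 'n) set" where
  "leaf w s = {(\<chi> j. complex_of_real (x $ j) * w s) |x::real ^ 'n. (\<Sum>j\<in>UNIV. (x $ j)\<^sup>2) = 1}"

definition leaf_union :: "(real \<Rightarrow> complex) \<Rightarrow> real set \<Rightarrow> (complex ^ 'n) set" where
  "leaf_union w I = (\<Union>s\<in>I. leaf w s)"

text \<open>\<open>leaf_union w I\<close> need not be embedded: the curve \<open>w\<close> may meet itself or \<open>-w\<close>. As an immersed
  submanifold it is the manifold \<open>sphere 0 1 \<times> I\<close> with the immersion \<open>L_map w\<close> and the metric
  induced by it; its submanifold \<open>leaf w s\<close> is \<open>sphere 0 1 \<times> {s}\<close>.\<close>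

definition L_map :: "(real \<Rightarrow> complex) \<Rightarrow> (real ^ 'n) \<times> real \<Rightarrow> complex ^ 'n" where
  "L_map w = (\<lambda>(x, s). \<chi> j. complex_of_real (x $ j) * w s)"

definition L_dom :: "real set \<Rightarrow> ((real ^ 'n) \<times> real) set" where
  "L_dom I = sphere 0 1 \<times> I"

lemma norm_1_iff_sum_squares: "norm (x::real ^ 'n) = 1 \<longleftrightarrow> (\<Sum>j\<in>UNIV. (x $ j)\<^sup>2) = 1"
  by (simp add: norm_vec_def L2_set_def)

lemma leaf_eq_image: "leaf w s = L_map w ` (L_dom {s} :: ((real ^ 'n) \<times> real) set)"
  by (force simp: leaf_def L_map_def L_dom_def norm_1_iff_sum_squares)

lemma leaf_union_eq_image:
  "leaf_union w I = L_map w ` (L_dom I :: ((real ^ 'n) \<times> real) set)"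
  by (force simp: leaf_union_def leaf_def L_map_def L_dom_def norm_1_iff_sum_squares)

text \<open>Tangent vectors of \<open>L\<close> at the image of \<open>(x, s)\<close>, as vectors of \<open>\<complex>\<^sup>n\<close>.\<close>

definition L_tangent :: "(real \<Rightarrow> complex) \<Rightarrow> real set \<Rightarrow> real ^ 'n \<Rightarrow> real \<Rightarrow> (complex ^ 'n) set" where
  "L_tangent w I x s = differential (L_dom I) (L_map w) (x, s) ` tangent_space (L_dom I) (x, s)"

definition L_partial_s :: "(real \<Rightarrow> complex) \<Rightarrow> real set \<Rightarrow> real ^ 'n \<Rightarrow> real \<Rightarrow> complex ^ 'n" where
  "L_partial_s w I x s = differential (L_dom I) (L_map w) (x, s) (0, 1)"

definition leaf_mean_curvature ::
  "(real \<Rightarrow> complex) \<Rightarrow> real set \<Rightarrow> real \<Rightarrow> real ^ 'n \<Rightarrow> complex ^ 'n" where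
  "leaf_mean_curvature w I s x = differential (L_dom I) (L_map w) (x, s)
     (mean_curvature_vector (L_dom I) (induced_metric (L_dom I) (L_map w)) (L_dom {s}) (x, s))"

text \<open>The family \<open>leaf w (f t)\<close>, \<open>t \<in> J\<close>, is a mean curvature flow in \<open>L\<close>. The type argument
  fixes the dimension \<open>n\<close>.\<close>

definition leaves_mean_curvature_flow ::
  "'n::finite itself \<Rightarrow> (real \<Rightarrow> complex) \<Rightarrow> real set \<Rightarrow> real set \<Rightarrow> (real \<Rightarrow> real) \<Rightarrow> bool" where
  "leaves_mean_curvature_flow _ w I J f \<longleftrightarrow> (\<forall>t\<in>J. \<forall>x\<in>sphere (0::real ^ 'n) 1.
     ((\<lambda>\<tau>. L_map w (x, f \<tau>)) has_vector_derivative leaf_mean_curvature w I (f t) x)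
       (at t within J))"

end

theory Submission
  imports Defs
begin

text \<open>On \<open>N = S\<^sup>n\<^sup>-\<^sup>1 \<times> I\<close> the immersion \<open>(x, s) \<mapsto> w(s)x\<close> induces a warped product metric. A tangent
  vector \<open>(z, b)\<close> satisfies \<open>z \<bullet> x = 0\<close> and is sent to \<open>z w + b x w'\<close>, so the metric is
  \<open>A(s) z \<bullet> z' + C(s) b b'\<close> with \<open>A = |w|\<^sup>2\<close> and \<open>C = |w'|\<^sup>2\<close>. Everything about the mean curvature
  follows from this block form, and the locale \<open>warped_cylinder\<close> treats arbitrary positive smooth
  coefficients \<open>A\<close> and \<open>C\<close>.

  The value of the mean curvature vector comes from the axioms of the Levi-Civita connection alone.
  Let \<open>T = \<partial>/\<partial>s\<close>, which spans the normal line of a slice, and let \<open>e\<close> be a field that is tangent to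
  the slice along the slice. Since \<open>g(e, T) = 0\<close> there, \<open>g(\<nabla>\<^sub>e e, T) = - g(e, \<nabla>\<^sub>e T)\<close>. As the vector
  field \<open>T\<close> is constant, \<open>\<nabla>\<^sub>e T = \<nabla>\<^sub>T e - D\<^sub>T e\<close>, while \<open>2 g(e, \<nabla>\<^sub>T e) = T(g(e, e))\<close> is
  \<open>A' |e|\<^sup>2 + 2 A e \<bullet> D\<^sub>T e\<close> on the slice, with Euclidean norm and inner product. The terms with \<open>D\<^sub>T e\<close> cancel and \<open>g(\<nabla>\<^sub>e e, T) = - (A'/2) |e|\<^sup>2\<close> remains
  (\<open>slice_second_fundamental_form\<close>). For a \<open>g\<close>-unit field \<open>|e|\<^sup>2 = 1/A\<close>, so each of the \<open>n - 1\<close>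
  members of a frame contributes \<open>- A' / (2 A C)\<close> times \<open>T\<close>, and \<open>A'/2 = Re (cnj w * w')\<close> yields the
  stated coefficient.

  The mean curvature vector is specified as the unique vector that some connection and some frame
  produce, so one Levi-Civita connection and one smooth orthonormal frame near a given point must
  also be exhibited. The connection is the ambient derivative plus an explicit symmetric bilinear
  term (\<open>levi_civita_connection\<close>). The frame is the image of a fixed orthonormal basis of the
  complement of \<open>x\<close> under the Householder reflection that takes \<open>- x\<close> to the moving point
  (\<open>slice_frame_exists\<close>). The flow statement is then the chain rule.\<close>

section \<open>Calculus of k times differentiable maps\<close>

text \<open>Openness of \<open>U\<close> matters: it lets equality of functions pass to their derivatives.\<close>

lemma Ck_on_cong:
  assumes "open U" "\<And>x. x \<in> U \<Longrightarrow> f x = g x" "Ck_on k U f"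
  shows "Ck_on k U g"
  using assms(2,3)
proof (induction k arbitrary: f g)
  case 0
  then show ?case by (metis Ck_on.simps(1) continuous_on_cong)
next
  case (Suc k)
  have D: "(g has_derivative frechet_derivative f (at x)) (at x)" if "x \<in> U" for x
  proof (rule has_derivative_transform_within_open)
    show "(f has_derivative frechet_derivative f (at x)) (at x)"
      using Suc.prems that by (simp add: frechet_derivative_works)
  qed (use assms(1) that Suc.prems(1) in auto)
  have "Ck_on k U (\<lambda>x. frechet_derivative g (at x) i)" if "i \<in> Basis" for i
    by (rule Suc.IH[of "\<lambda>x. frechet_derivative f (at x) i"])
      (use Suc.prems(2) that frechet_derivative_at[OF D] in auto)
  then show ?case using D by (auto simp: differentiable_def)
qed

text \<open>Any pointwise derivative may replace \<open>frechet_derivative\<close> here, so that the calculus rules can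
  be proved by exhibiting the derivative they produce.\<close>

lemma Ck_on_SucI:
  assumes "open U" "\<And>x. x \<in> U \<Longrightarrow> (f has_derivative D x) (at x)"
    and "\<And>i. i \<in> Basis \<Longrightarrow> Ck_on k U (\<lambda>x. D x i)"
  shows "Ck_on (Suc k) U f"
proof -
  have "Ck_on k U (\<lambda>x. frechet_derivative f (at x) i)" if "i \<in> Basis" for i
    by (rule Ck_on_cong[OF assms(1) _ assms(3)[OF that]])
      (simp add: frechet_derivative_at[OF assms(2), symmetric])
  then show ?thesis using assms(2) by (auto simp: differentiable_def)
qed

lemma Ck_on_Suc_has_derivative:
  "Ck_on (Suc k) U f \<Longrightarrow> x \<in> U \<Longrightarrow> (f has_derivative frechet_derivative f (at x)) (at x)"
  by (simp add: frechet_derivative_works)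

lemma Ck_on_Suc_partial:
  "Ck_on (Suc k) U f \<Longrightarrow> i \<in> Basis \<Longrightarrow> Ck_on k U (\<lambda>x. frechet_derivative f (at x) i)"
  by simp

declare Ck_on.simps(2)[simp del]

lemma Ck_on_Suc_imp_Ck_on: "Ck_on (Suc k) U f \<Longrightarrow> Ck_on k U f"
proof (induction k arbitrary: f)
  case 0
  then show ?case
    by (auto simp: Ck_on.simps
        intro!: continuous_at_imp_continuous_on differentiable_imp_continuous_within)
next
  case (Suc k)
  have "Ck_on k U (\<lambda>x. frechet_derivative f (at x) i)" if "i \<in> Basis" for i
    by (rule Suc.IH, rule Ck_on_Suc_partial) fact+
  then show ?case using Suc.prems by (auto simp: Ck_on.simps)
qed

lemma Ck_on_subset: "Ck_on k U f \<Longrightarrow> V \<subseteq> U \<Longrightarrow> Ck_on k V f"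
  by (induction k arbitrary: f) (auto simp: Ck_on.simps intro: continuous_on_subset)

lemma Ck_on_const: "open U \<Longrightarrow> Ck_on k U (\<lambda>x. c)"
proof (induction k arbitrary: c)
  case (Suc k)
  show ?case
    by (rule Ck_on_SucI[where D = "\<lambda>_ _. 0"]) (use Suc in auto)
qed simp

lemma Ck_on_ident: "open U \<Longrightarrow> Ck_on k U (\<lambda>x. x)"
proof (cases k)
  case (Suc m)
  assume "open U"
  then show ?thesis unfolding Suc
    by (intro Ck_on_SucI[where D = "\<lambda>_ v. v"]) (auto intro: Ck_on_const)
qed auto

lemma Ck_on_linear:
  assumes "bounded_linear L" "open U"
  shows "Ck_on k U f \<Longrightarrow> Ck_on k U (\<lambda>x. L (f x))"
proof (induction k arbitrary: f)
  case 0
  then show ?case using bounded_linear.continuous_on[OF assms(1)] by auto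
next
  case (Suc k)
  show ?case
  proof (rule Ck_on_SucI[OF assms(2)])
    show "((\<lambda>x. L (f x)) has_derivative (\<lambda>v. L (frechet_derivative f (at x) v))) (at x)"
      if "x \<in> U" for x
      by (rule bounded_linear.has_derivative[OF assms(1) Ck_on_Suc_has_derivative[OF Suc.prems that]])
    show "Ck_on k U (\<lambda>x. L (frechet_derivative f (at x) i))" if "i \<in> Basis" for i
      by (rule Suc.IH[OF Ck_on_Suc_partial[OF Suc.prems that]])
  qed
qed

lemma Ck_on_add:
  assumes "open U"
  shows "Ck_on k U f \<Longrightarrow> Ck_on k U g \<Longrightarrow> Ck_on k U (\<lambda>x. f x + g x)"
proof (induction k arbitrary: f g)
  case 0
  then show ?case by (simp add: continuous_on_add)
next
  case (Suc k)
  show ?case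
  proof (rule Ck_on_SucI[OF assms])
    show "((\<lambda>x. f x + g x) has_derivative
        (\<lambda>v. frechet_derivative f (at x) v + frechet_derivative g (at x) v)) (at x)"
      if "x \<in> U" for x
      by (intro has_derivative_add Ck_on_Suc_has_derivative[OF Suc.prems(1) that]
          Ck_on_Suc_has_derivative[OF Suc.prems(2) that])
    show "Ck_on k U (\<lambda>x. frechet_derivative f (at x) i + frechet_derivative g (at x) i)"
      if "i \<in> Basis" for i
      by (rule Suc.IH[OF Ck_on_Suc_partial[OF Suc.prems(1) that]
            Ck_on_Suc_partial[OF Suc.prems(2) that]])
  qed
qed

lemma Ck_on_sum:
  assumes "open U" "\<And>i. i \<in> S \<Longrightarrow> Ck_on k U (f i)"
  shows "Ck_on k U (\<lambda>x. \<Sum>i\<in>S. f i x)"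
  using assms(2)
  by (induction S rule: infinite_finite_induct) (auto intro: Ck_on_const Ck_on_add assms(1))

lemma Ck_on_bilinear:
  assumes "bounded_bilinear B" "open U"
  shows "Ck_on k U f \<Longrightarrow> Ck_on k U g \<Longrightarrow> Ck_on k U (\<lambda>x. B (f x) (g x))"
proof (induction k arbitrary: f g)
  case 0
  then show ?case using bounded_bilinear.continuous_on[OF assms(1)] by auto
next
  case (Suc k)
  note lower = Suc.prems[THEN Ck_on_Suc_imp_Ck_on]
  show ?case
  proof (rule Ck_on_SucI[OF assms(2)])
    show "((\<lambda>x. B (f x) (g x)) has_derivative
        (\<lambda>v. B (f x) (frechet_derivative g (at x) v) + B (frechet_derivative f (at x) v) (g x))) (at x)"
      if "x \<in> U" for x
      by (rule bounded_bilinear.FDERIV[OF assms(1) Ck_on_Suc_has_derivative[OF Suc.prems(1) that]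
            Ck_on_Suc_has_derivative[OF Suc.prems(2) that]])
    show "Ck_on k U (\<lambda>x. B (f x) (frechet_derivative g (at x) i)
        + B (frechet_derivative f (at x) i) (g x))" if "i \<in> Basis" for i
      by (rule Ck_on_add[OF assms(2) Suc.IH[OF lower(1) Ck_on_Suc_partial[OF Suc.prems(2) that]]
            Suc.IH[OF Ck_on_Suc_partial[OF Suc.prems(1) that] lower(2)]])
  qed
qed

lemma Ck_on_inverse:
  fixes f :: "'a::euclidean_space \<Rightarrow> real"
  assumes "open U" "\<And>x. x \<in> U \<Longrightarrow> f x \<noteq> 0"
  shows "Ck_on k U f \<Longrightarrow> Ck_on k U (\<lambda>x. inverse (f x))"
proof (induction k)
  case 0
  then show ?case using assms(2) by (simp add: continuous_on_inverse)
next
  case (Suc k)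
  have inv: "Ck_on k U (\<lambda>x. inverse (f x))"
    using Suc by (simp add: Ck_on_Suc_imp_Ck_on)
  show ?case
  proof (rule Ck_on_SucI[OF assms(1)])
    show "((\<lambda>x. inverse (f x)) has_derivative
        (\<lambda>v. - (inverse (f x) * frechet_derivative f (at x) v * inverse (f x)))) (at x)"
      if "x \<in> U" for x
      by (rule Deriv.has_derivative_inverse[OF assms(2)[OF that]
            Ck_on_Suc_has_derivative[OF Suc.prems that]])
    show "Ck_on k U (\<lambda>x. - (inverse (f x) * frechet_derivative f (at x) i * inverse (f x)))"
      if "i \<in> Basis" for i
      by (rule Ck_on_linear[OF bounded_linear_minus[OF bounded_linear_ident] assms(1)
            Ck_on_bilinear[OF bounded_bilinear_mult assms(1)
              Ck_on_bilinear[OF bounded_bilinear_mult assms(1) inv Ck_on_Suc_partial[OF Suc.prems that]]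
              inv]])
  qed
qed

text \<open>The partial derivatives of \<open>f \<circ> L\<close> are combinations, with constant coefficients, of the partial
  derivatives of \<open>f\<close> composed with \<open>L\<close>, so the induction does not need a general chain rule.\<close>

lemma Ck_on_compose_linear:
  fixes L :: "'a::euclidean_space \<Rightarrow> 'b::euclidean_space"
  assumes "bounded_linear L" "open U" "L ` U \<subseteq> V"
  shows "Ck_on k V f \<Longrightarrow> Ck_on k U (\<lambda>x. f (L x))"
proof (induction k arbitrary: f)
  case 0
  then have "continuous_on V f" by simp
  then have "continuous_on U (\<lambda>x. f (L x))"
    by (rule continuous_on_compose2[OF _ linear_continuous_on[OF assms(1)] assms(3)])
  then show ?case by simp
next
  case (Suc k)
  have fder: "(f has_derivative frechet_derivative f (at (L x))) (at (L x))" if "x \<in> U" for x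
    using that assms(3) by (intro Ck_on_Suc_has_derivative[OF Suc.prems]) blast
  show ?case
  proof (rule Ck_on_SucI[OF assms(2)])
    show "((\<lambda>x. f (L x)) has_derivative (\<lambda>v. frechet_derivative f (at (L x)) (L v))) (at x)"
      if "x \<in> U" for x
      by (rule has_derivative_compose[OF bounded_linear_imp_has_derivative[OF assms(1)] fder[OF that]])
    fix i :: 'a
    show "Ck_on k U (\<lambda>x. frechet_derivative f (at (L x)) (L i))"
    proof (rule Ck_on_cong[OF assms(2)])
      show "Ck_on k U (\<lambda>x. \<Sum>j\<in>Basis. (L i \<bullet> j) *\<^sub>R frechet_derivative f (at (L x)) j)"
      proof (rule Ck_on_sum[OF assms(2)])
        fix j :: 'b assume "j \<in> Basis"
        then show "Ck_on k U (\<lambda>x. (L i \<bullet> j) *\<^sub>R frechet_derivative f (at (L x)) j)"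
          by (rule Ck_on_linear[OF bounded_linear_scaleR_right assms(2)
                Suc.IH[OF Ck_on_Suc_partial[OF Suc.prems]]])
      qed
    next
      fix x assume "x \<in> U"
      then have lin: "linear (frechet_derivative f (at (L x)))"
        using fder has_derivative_linear by blast
      have "frechet_derivative f (at (L x)) (L i)
          = frechet_derivative f (at (L x)) (\<Sum>j\<in>Basis. (L i \<bullet> j) *\<^sub>R j)"
        by (simp add: euclidean_representation)
      also have "\<dots> = (\<Sum>j\<in>Basis. (L i \<bullet> j) *\<^sub>R frechet_derivative f (at (L x)) j)"
        by (simp add: linear_sum[OF lin] linear_cmul[OF lin])
      finally show "(\<Sum>j\<in>Basis. (L i \<bullet> j) *\<^sub>R frechet_derivative f (at (L x)) j)
          = frechet_derivative f (at (L x)) (L i)" by simp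
    qed
  qed
qed

section \<open>Smooth maps, tangent vectors and differentials\<close>

lemma smooth_onI:
  assumes "\<And>p. p \<in> S \<Longrightarrow> \<exists>U h. open U \<and> p \<in> U \<and> (\<forall>k. Ck_on k U h) \<and> (\<forall>x\<in>S \<inter> U. h x = f x)"
  shows "smooth_on S f"
  unfolding smooth_on_def using assms by (rule ballI)

lemma smooth_onE:
  assumes "smooth_on S f" "p \<in> S"
  obtains U h where "open U" "p \<in> U" "\<And>k. Ck_on k U h" "\<And>x. x \<in> S \<Longrightarrow> x \<in> U \<Longrightarrow> h x = f x"
proof -
  from bspec[OF assms(1)[unfolded smooth_on_def] assms(2)]
  obtain U h where h: "open U \<and> p \<in> U \<and> (\<forall>k. Ck_on k U h) \<and> (\<forall>x\<in>S \<inter> U. h x = f x)"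
    by (elim exE)
  show thesis by (rule that[of U h]) (use h in simp_all)
qed

lemma smooth_on_cong:
  assumes "smooth_on S f" "\<And>x. x \<in> S \<Longrightarrow> f x = g x"
  shows "smooth_on S g"
proof (rule smooth_onI)
  fix p assume "p \<in> S"
  obtain U h where h: "open U" "p \<in> U" "\<And>k. Ck_on k U h" "\<And>x. x \<in> S \<Longrightarrow> x \<in> U \<Longrightarrow> h x = f x"
    by (rule smooth_onE[OF assms(1) \<open>p \<in> S\<close>]) blast
  then show "\<exists>U h. open U \<and> p \<in> U \<and> (\<forall>k. Ck_on k U h) \<and> (\<forall>x\<in>S \<inter> U. h x = g x)"
    using assms(2) by (intro exI[of _ U] exI[of _ h]) auto
qed

lemma smooth_on_const: "smooth_on S (\<lambda>x. c)"
  by (rule smooth_onI, intro exI[of _ UNIV] exI[of _ "\<lambda>_. c"]) (simp add: Ck_on_const)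

lemma smooth_on_ident: "smooth_on S (\<lambda>x. x)"
  by (rule smooth_onI, intro exI[of _ UNIV] exI[of _ "\<lambda>x. x"]) (simp add: Ck_on_ident)

lemma smooth_on_linear:
  assumes "bounded_linear L" "smooth_on S f"
  shows "smooth_on S (\<lambda>x. L (f x))"
proof (rule smooth_onI)
  fix p assume "p \<in> S"
  with assms(2) obtain U h where h: "open U" "p \<in> U" "\<And>k. Ck_on k U h"
    "\<And>x. x \<in> S \<Longrightarrow> x \<in> U \<Longrightarrow> h x = f x"
    by (rule smooth_onE) blast
  then show "\<exists>U h. open U \<and> p \<in> U \<and> (\<forall>k. Ck_on k U h) \<and> (\<forall>x\<in>S \<inter> U. h x = L (f x))"
    by (intro exI[of _ U] exI[of _ "\<lambda>x. L (h x)"]) (simp add: Ck_on_linear[OF assms(1)])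
qed

lemma smooth_on_bilinear:
  assumes "bounded_bilinear B" "smooth_on S f" "smooth_on S g"
  shows "smooth_on S (\<lambda>x. B (f x) (g x))"
proof (rule smooth_onI)
  fix p assume p: "p \<in> S"
  obtain U h where h: "open U" "p \<in> U" "\<And>k. Ck_on k U h" "\<And>x. x \<in> S \<Longrightarrow> x \<in> U \<Longrightarrow> h x = f x"
    by (rule smooth_onE[OF assms(2) p]) blast
  obtain V i where i: "open V" "p \<in> V" "\<And>k. Ck_on k V i" "\<And>x. x \<in> S \<Longrightarrow> x \<in> V \<Longrightarrow> i x = g x"
    by (rule smooth_onE[OF assms(3) p]) blast
  have "Ck_on k (U \<inter> V) (\<lambda>x. B (h x) (i x))" for k
    using h i by (intro Ck_on_bilinear[OF assms(1)]) (auto intro: Ck_on_subset)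
  with h i show "\<exists>U h. open U \<and> p \<in> U \<and> (\<forall>k. Ck_on k U h) \<and> (\<forall>x\<in>S \<inter> U. h x = B (f x) (g x))"
    by (intro exI[of _ "U \<inter> V"] exI[of _ "\<lambda>x. B (h x) (i x)"]) auto
qed

lemmas smooth_on_scaleR = smooth_on_bilinear[OF bounded_bilinear_scaleR]
lemmas smooth_on_mult = smooth_on_bilinear[OF bounded_bilinear_mult]
lemmas smooth_on_inner = smooth_on_bilinear[OF bounded_bilinear_inner]
lemmas smooth_on_fst = smooth_on_linear[OF bounded_linear_fst]
lemmas smooth_on_snd = smooth_on_linear[OF bounded_linear_snd]

lemma smooth_on_add:
  assumes "smooth_on S f" "smooth_on S g"
  shows "smooth_on S (\<lambda>x. f x + g x)"
proof (rule smooth_onI)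
  fix p assume p: "p \<in> S"
  obtain U h where h: "open U" "p \<in> U" "\<And>k. Ck_on k U h" "\<And>x. x \<in> S \<Longrightarrow> x \<in> U \<Longrightarrow> h x = f x"
    by (rule smooth_onE[OF assms(1) p]) blast
  obtain V i where i: "open V" "p \<in> V" "\<And>k. Ck_on k V i" "\<And>x. x \<in> S \<Longrightarrow> x \<in> V \<Longrightarrow> i x = g x"
    by (rule smooth_onE[OF assms(2) p]) blast
  have "Ck_on k (U \<inter> V) (\<lambda>x. h x + i x)" for k
    using h i by (intro Ck_on_add) (auto intro: Ck_on_subset)
  with h i show "\<exists>U h. open U \<and> p \<in> U \<and> (\<forall>k. Ck_on k U h) \<and> (\<forall>x\<in>S \<inter> U. h x = f x + g x)"
    by (intro exI[of _ "U \<inter> V"] exI[of _ "\<lambda>x. h x + i x"]) auto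
qed

lemma smooth_on_diff:
  "smooth_on S f \<Longrightarrow> smooth_on S g \<Longrightarrow> smooth_on S (\<lambda>x. f x - g x)"
  using smooth_on_add[of S f "\<lambda>x. - g x"]
    smooth_on_linear[OF bounded_linear_minus[OF bounded_linear_ident], of S g] by simp

lemma smooth_on_Pair:
  assumes "smooth_on S f" "smooth_on S g"
  shows "smooth_on S (\<lambda>x. (f x, g x))"
proof -
  have l: "bounded_linear (\<lambda>u. (u, 0))" "bounded_linear (\<lambda>u. (0, u))"
    by (auto intro: bounded_linear_Pair bounded_linear_ident bounded_linear_zero)
  show ?thesis
    using smooth_on_add[OF smooth_on_linear[OF l(1) assms(1)] smooth_on_linear[OF l(2) assms(2)]]
    by simp
qed

text \<open>A local extension may vanish off \<open>S\<close>; its zeros form a relatively closed set, which is removed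
  from its domain.\<close>

lemma smooth_on_inverse:
  fixes f :: "'a::euclidean_space \<Rightarrow> real"
  assumes "smooth_on S f" "\<And>x. x \<in> S \<Longrightarrow> f x \<noteq> 0"
  shows "smooth_on S (\<lambda>x. inverse (f x))"
proof (rule smooth_onI)
  fix p assume p: "p \<in> S"
  obtain U h where h: "open U" "p \<in> U" "\<And>k. Ck_on k U h" "\<And>x. x \<in> S \<Longrightarrow> x \<in> U \<Longrightarrow> h x = f x"
    by (rule smooth_onE[OF assms(1) p]) blast
  define V where "V = {x\<in>U. h x \<noteq> 0}"
  have "continuous_on U h" using h(3)[of 0] by simp
  moreover have "V = U \<inter> h -` (- {0})" by (auto simp: V_def)
  ultimately have V: "open V" using continuous_open_preimage[OF _ h(1), of h "- {0}"]
    by (simp add: open_Compl)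
  have "Ck_on k V (\<lambda>x. inverse (h x))" for k
    by (intro Ck_on_inverse V Ck_on_subset[OF h(3)]) (auto simp: V_def)
  with V show "\<exists>U h. open U \<and> p \<in> U \<and> (\<forall>k. Ck_on k U h) \<and> (\<forall>x\<in>S \<inter> U. h x = inverse (f x))"
    using h p assms(2) by (intro exI[of _ V] exI[of _ "\<lambda>x. inverse (h x)"]) (auto simp: V_def)
qed

lemma smooth_on_compose_linear:
  fixes L :: "'a::euclidean_space \<Rightarrow> 'b::euclidean_space"
  assumes "bounded_linear L" "smooth_on T f" "L ` S \<subseteq> T"
  shows "smooth_on S (\<lambda>x. f (L x))"
proof (rule smooth_onI)
  fix p assume "p \<in> S"
  with assms(3) have "L p \<in> T" by auto
  then obtain U h where h: "open U" "L p \<in> U" "\<And>k. Ck_on k U h"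
    "\<And>x. x \<in> T \<Longrightarrow> x \<in> U \<Longrightarrow> h x = f x"
    by (rule smooth_onE[OF assms(2)]) blast
  have o: "open (L -` U)" by (rule open_vimage[OF h(1) linear_continuous_on[OF assms(1)]])
  have "Ck_on k (L -` U) (\<lambda>x. h (L x))" for k
    by (rule Ck_on_compose_linear[OF assms(1) o _ h(3)]) auto
  with o h assms(3) show "\<exists>U h. open U \<and> p \<in> U \<and> (\<forall>k. Ck_on k U h) \<and> (\<forall>x\<in>S \<inter> U. h x = f (L x))"
    by (intro exI[of _ "L -` U"] exI[of _ "\<lambda>x. h (L x)"]) auto
qed

text \<open>One extension computes the derivatives of \<open>f\<close> within \<open>S\<close> at all nearby points of \<open>S\<close>
  simultaneously. This makes derivatives of smooth maps smooth.\<close>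

lemma smooth_on_extension_derivative:
  assumes "smooth_on S f" "p \<in> S"
  obtains U h where "open U" "p \<in> U" "\<And>k. Ck_on k U h"
    "\<And>q. q \<in> S \<Longrightarrow> q \<in> U \<Longrightarrow> (f has_derivative frechet_derivative h (at q)) (at q within S)"
proof -
  obtain U h where h: "open U" "p \<in> U" "\<And>k. Ck_on k U h" "\<And>x. x \<in> S \<Longrightarrow> x \<in> U \<Longrightarrow> h x = f x"
    by (rule smooth_onE[OF assms]) blast
  have "(f has_derivative frechet_derivative h (at q)) (at q within S)" if q: "q \<in> S" "q \<in> U" for q
  proof -
    obtain e where e: "e > 0" "ball q e \<subseteq> U" using h(1) q(2) open_contains_ball by blast
    have "(h has_derivative frechet_derivative h (at q)) (at q within S)"
      by (rule has_derivative_at_withinI[OF Ck_on_Suc_has_derivative[OF h(3)[of "Suc 0"] q(2)]])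
    then show ?thesis
      by (rule has_derivative_transform_within[OF _ e(1) q(1)])
        (use e(2) h(4) in \<open>auto simp: dist_commute subset_iff\<close>)
  qed
  then show thesis using h that by blast
qed

lemma smooth_on_differentiable: "smooth_on S f \<Longrightarrow> p \<in> S \<Longrightarrow> f differentiable (at p within S)"
  unfolding differentiable_def by (rule smooth_on_extension_derivative) blast+

text \<open>Derivatives within \<open>N\<close> need not be unique, but on the velocity of a curve in \<open>N\<close> each of them must
  return the derivative of \<open>f\<close> along that curve; linearity extends this to the span.\<close>

lemma tangent_derivative_unique:
  assumes D: "(f has_derivative D) (at p within N)" and E: "(f has_derivative E) (at p within N)"
    and v: "v \<in> tangent_space N p"
  shows "D v = E v"
proof -
  have lin: "linear D" "linear E" using D E has_derivative_linear by auto
  have *: "D u = E u" if c: "\<epsilon> > 0" "c 0 = p" "c ` {0..<\<epsilon>} \<subseteq> N"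
    "(c has_vector_derivative u) (at (0::real) within {0..<\<epsilon>})" for u c \<epsilon>
  proof -
    have d: "((\<lambda>t. f (c t)) has_vector_derivative F u) (at 0 within {0..<\<epsilon>})"
      if F: "(f has_derivative F) (at p within N)" for F
    proof -
      have lin: "linear F" using F by (rule has_derivative_linear)
      have "(f has_derivative F) (at (c 0) within c ` {0..<\<epsilon>})"
        unfolding c(2) by (rule has_derivative_subset[OF F c(3)])
      from has_derivative_in_compose[OF c(4)[unfolded has_vector_derivative_def] this]
      show ?thesis
        unfolding has_vector_derivative_def by (simp add: linear_cmul[OF lin])
    qed
    have "at 0 within {0..<\<epsilon>} \<noteq> bot"
      using c(1) by (simp add: trivial_limit_within)
    then show ?thesis by (rule vector_derivative_unique_within[OF _ d[OF D] d[OF E]])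
  qed
  show ?thesis
    by (rule linear_eq_on_span[OF lin _ v[unfolded tangent_space_def]]) (use * in blast)
qed

text \<open>Every differential on a tangent vector is computed by exhibiting some derivative.\<close>

lemma differential_eq:
  assumes "(f has_derivative D) (at p within N)" "v \<in> tangent_space N p"
  shows "differential N f p v = D v"
proof -
  have "(f has_derivative frechet_derivative f (at p within N)) (at p within N)"
    using assms(1) by (auto simp: frechet_derivative_works[symmetric] differentiable_def)
  then show ?thesis
    unfolding differential_def using assms by (rule tangent_derivative_unique)
qed

lemma has_derivative_differential:
  "smooth_on N f \<Longrightarrow> p \<in> N \<Longrightarrow> (f has_derivative differential N f p) (at p within N)"
  unfolding differential_def by (simp add: smooth_on_differentiable frechet_derivative_works[symmetric])

lemma tangent_space_mono: "M \<subseteq> N \<Longrightarrow> tangent_space M p \<subseteq> tangent_space N p"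
  unfolding tangent_space_def by (intro span_mono) blast

text \<open>A curve through \<open>p\<close> stays in \<open>U\<close> for a short time.\<close>

lemma tangent_space_Int_open:
  assumes "open U" "p \<in> U"
  shows "tangent_space (N \<inter> U) p = tangent_space N p"
proof (rule antisym)
  show "tangent_space N p \<subseteq> tangent_space (N \<inter> U) p"
    unfolding tangent_space_def
  proof (rule span_mono, safe)
    fix v c and \<epsilon> :: real
    assume c: "\<epsilon> > 0" "p = c 0" "c ` {0..<\<epsilon>} \<subseteq> N"
      "(c has_vector_derivative v) (at 0 within {0..<\<epsilon>})"
    have "continuous (at 0 within {0..<\<epsilon>}) c" using c(4) has_vector_derivative_continuous by blast
    moreover obtain e where e: "e > 0" "ball (c 0) e \<subseteq> U"
      using assms c(2) open_contains_ball by blast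
    ultimately obtain d where d: "d > 0" "\<And>t. t \<in> {0..<\<epsilon>} \<Longrightarrow> dist t 0 < d \<Longrightarrow> dist (c t) (c 0) < e"
      unfolding continuous_within_eps_delta by blast
    have dU: "c t \<in> U" if "t \<in> {0..<\<epsilon>}" "t < d" for t
      using d(2)[of t] that e(2) by (auto simp: dist_commute subset_iff)
    have "(c has_vector_derivative v) (at 0 within {0..<min d \<epsilon>})"
      by (rule has_vector_derivative_within_subset[OF c(4)]) auto
    moreover have "c ` {0..<min d \<epsilon>} \<subseteq> N \<inter> U" using c(3) dU by auto
    ultimately show "\<exists>c' \<epsilon>'. 0 < \<epsilon>' \<and> c' 0 = c 0 \<and> c' ` {0..<\<epsilon>'} \<subseteq> N \<inter> U \<and>
        (c' has_vector_derivative v) (at 0 within {0..<\<epsilon>'})"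
      using c d by (intro exI[of _ c] exI[of _ "min d \<epsilon>"]) auto
  qed
qed (simp add: tangent_space_mono)

text \<open>On \<open>S\<close> the map equals the directional derivative of an extension of \<open>f\<close> along an extension of
  \<open>X\<close>, a finite sum of products of \<open>C\<^sup>k\<close> functions for every \<open>k\<close>. The tangency of \<open>X\<close> makes the
  choice of the extensions immaterial.\<close>

lemma smooth_on_differential:
  assumes f: "smooth_on S f" and X: "smooth_on S X" "\<And>p. p \<in> S \<Longrightarrow> X p \<in> tangent_space S p"
  shows "smooth_on S (\<lambda>p. differential S f p (X p))"
proof (rule smooth_onI)
  fix p assume p: "p \<in> S"
  obtain U h where h: "open U" "p \<in> U" "\<And>k. Ck_on k U h"
    "\<And>q. q \<in> S \<Longrightarrow> q \<in> U \<Longrightarrow> (f has_derivative frechet_derivative h (at q)) (at q within S)"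
    by (rule smooth_on_extension_derivative[OF f p]) blast
  obtain V Y where Y: "open V" "p \<in> V" "\<And>k. Ck_on k V Y" "\<And>x. x \<in> S \<Longrightarrow> x \<in> V \<Longrightarrow> Y x = X x"
    by (rule smooth_onE[OF X(1) p]) blast
  let ?e = "\<lambda>q. \<Sum>i\<in>Basis. (Y q \<bullet> i) *\<^sub>R frechet_derivative h (at q) i"
  have UV: "open (U \<inter> V)" using h Y by auto
  have "Ck_on k (U \<inter> V) ?e" for k
  proof (rule Ck_on_sum[OF UV])
    fix i :: 'a assume i: "i \<in> Basis"
    have 1: "Ck_on k (U \<inter> V) (\<lambda>q. Y q \<bullet> i)"
      by (rule Ck_on_linear[OF bounded_linear_inner_left UV Ck_on_subset[OF Y(3)]]) auto
    have 2: "Ck_on k (U \<inter> V) (\<lambda>q. frechet_derivative h (at q) i)"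
      by (rule Ck_on_subset[OF Ck_on_Suc_partial[OF h(3) i]]) auto
    show "Ck_on k (U \<inter> V) (\<lambda>q. (Y q \<bullet> i) *\<^sub>R frechet_derivative h (at q) i)"
      by (rule Ck_on_bilinear[OF bounded_bilinear_scaleR UV 1 2])
  qed
  moreover have "?e q = differential S f q (X q)" if "q \<in> S \<inter> (U \<inter> V)" for q
  proof -
    have lin: "linear (frechet_derivative h (at q))"
      using h(4) that has_derivative_linear by blast
    have "frechet_derivative h (at q) (X q)
        = frechet_derivative h (at q) (\<Sum>i\<in>Basis. (X q \<bullet> i) *\<^sub>R i)"
      by (simp add: euclidean_representation)
    also have "\<dots> = (\<Sum>i\<in>Basis. (X q \<bullet> i) *\<^sub>R frechet_derivative h (at q) i)"
      by (simp add: linear_sum[OF lin] linear_cmul[OF lin])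
    finally show ?thesis
      using differential_eq[OF h(4) X(2)] that Y(4) by auto
  qed
  ultimately show "\<exists>U h. open U \<and> p \<in> U \<and> (\<forall>k. Ck_on k U h) \<and>
      (\<forall>x\<in>S \<inter> U. h x = differential S f x (X x))"
    using UV h(2) Y(2) by (intro exI[of _ "U \<inter> V"] exI[of _ ?e]) auto
qed

section \<open>Tangent spaces of the sphere times an interval\<close>

lemma has_derivative_constant_on:
  assumes f: "(f has_derivative D) (at p within N)" and "p \<in> N" "\<And>q. q \<in> N \<Longrightarrow> f q = c"
    and v: "v \<in> tangent_space N p"
  shows "D v = 0"
proof -
  have "(f has_derivative (\<lambda>_. 0)) (at p within N)"
    by (rule has_derivative_transform[OF assms(2) _ has_derivative_const[of c]]) (use assms(3) in simp)
  then show ?thesis using tangent_derivative_unique[OF f _ v] by simp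
qed

lemma tangent_spaceI:
  assumes "\<epsilon> > 0" "c 0 = p" "\<And>t. 0 \<le> t \<Longrightarrow> t < \<epsilon> \<Longrightarrow> c t \<in> N"
    "(c has_vector_derivative v) (at (0::real))"
  shows "v \<in> tangent_space N p"
  unfolding tangent_space_def
proof (rule span_base, rule CollectI, intro exI conjI)
  show "c ` {0..<\<epsilon>} \<subseteq> N" using assms(3) by auto
qed (use assms has_vector_derivative_at_within in auto)

lemma subspace_tangent_space: "subspace (tangent_space N p)"
  by (simp add: tangent_space_def)

text \<open>The function \<open>x \<bullet> x\<close> is constant on the sphere.\<close>

lemma tangent_space_L_dom_constraint:
  assumes "(z, b) \<in> tangent_space (L_dom I) (x, s)" "norm (x :: real ^ 'n) = 1" "s \<in> I"
  shows "z \<bullet> x = 0"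
proof -
  have "((\<lambda>q. fst q \<bullet> fst q) has_derivative (\<lambda>v. x \<bullet> fst v + fst v \<bullet> x)) (at (x, s) within L_dom I)"
    by (auto intro!: derivative_eq_intros)
  from has_derivative_constant_on[OF this _ _ assms(1), where c = 1] show ?thesis
    using assms(2,3) by (auto simp: L_dom_def dot_square_norm inner_commute)
qed

text \<open>For a unit vector \<open>z\<close> the great circle \<open>cos t x + sin t z\<close> has velocity \<open>z\<close>.\<close>

lemma sphere_direction_tangent:
  assumes "z \<bullet> x = 0" "norm (x :: real ^ 'n) = 1" "s \<in> I"
  shows "(z, 0) \<in> tangent_space (L_dom I) (x, s)"
proof (cases "z = 0")
  case True
  show ?thesis
    unfolding True zero_prod_def[symmetric] by (rule subspace_0[OF subspace_tangent_space])
next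
  case False
  define e where "e = z /\<^sub>R norm z"
  have e: "norm e = 1" "e \<bullet> x = 0" "z = norm z *\<^sub>R e" using False assms(1) by (auto simp: e_def)
  have "(e, 0) \<in> tangent_space (L_dom I) (x, s)"
  proof (rule tangent_spaceI[where c = "\<lambda>t. (cos t *\<^sub>R x + sin t *\<^sub>R e, s)" and \<epsilon> = 1])
    fix t :: real
    have "(cos t *\<^sub>R x + sin t *\<^sub>R e) \<bullet> (cos t *\<^sub>R x + sin t *\<^sub>R e)
        = (cos t)\<^sup>2 * (x \<bullet> x) + (sin t)\<^sup>2 * (e \<bullet> e)"
      using e(2) by (simp add: inner_add inner_commute[of x e] power2_eq_square)
    then have "norm (cos t *\<^sub>R x + sin t *\<^sub>R e) = 1"
      using e(1) assms(2) by (simp add: norm_eq_1)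
    then show "(cos t *\<^sub>R x + sin t *\<^sub>R e, s) \<in> L_dom I"
      using assms(3) by (simp add: L_dom_def)
  qed (auto intro!: derivative_eq_intros has_vector_derivative_Pair)
  then have "norm z *\<^sub>R (e, 0) \<in> tangent_space (L_dom I) (x, s)"
    by (rule subspace_scale[OF subspace_tangent_space])
  then show ?thesis using e(3) by simp
qed

lemma tangent_space_L_dom_singleton:
  assumes "norm (x :: real ^ 'n) = 1"
  shows "tangent_space (L_dom {s}) (x, s) = {(z, b). z \<bullet> x = 0 \<and> b = 0}"
proof -
  have "b = 0" if "(z, b) \<in> tangent_space (L_dom {s}) (x, s)" for z :: "real ^ 'n" and b
  proof -
    have "(snd has_derivative snd) (at (x, s) within L_dom {s})"
      by (auto intro!: derivative_eq_intros)
    from has_derivative_constant_on[OF this _ _ that, where c = s] show ?thesis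
      using assms by (auto simp: L_dom_def)
  qed
  then show ?thesis
    using tangent_space_L_dom_constraint[OF _ assms] sphere_direction_tangent[OF _ assms] by fast
qed

text \<open>At an endpoint of \<open>I\<close> only one of the two directions stays in \<open>I\<close>. The span in the definition of
  the tangent space makes up for the sign.\<close>

lemma interval_inward_direction:
  fixes I :: "real set"
  assumes "is_interval I" "\<exists>u\<in>I. \<exists>v\<in>I. u < v" "s \<in> I"
  obtains \<sigma> \<epsilon> where "\<sigma> \<in> {1, -1}" "\<epsilon> > 0" "\<And>t. 0 \<le> t \<Longrightarrow> t < \<epsilon> \<Longrightarrow> s + \<sigma> * t \<in> I"
proof -
  obtain u v where uv: "u \<in> I" "v \<in> I" "u < v" using assms(2) by blast
  show thesis
  proof (cases "s < v")
    case True
    show thesis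
    proof (rule that[of 1 "v - s"])
      show "s + 1 * t \<in> I" if "0 \<le> t" "t < v - s" for t
        by (rule mem_is_interval_1_I[OF assms(1) assms(3) uv(2)]) (use that in simp_all)
    qed (use True in simp_all)
  next
    case False
    show thesis
    proof (rule that[of "-1" "s - u"])
      show "s + (- 1) * t \<in> I" if "0 \<le> t" "t < s - u" for t
        by (rule mem_is_interval_1_I[OF assms(1) uv(1) assms(3)]) (use that in simp_all)
    qed (use False uv(3) in simp_all)
  qed
qed

lemma unit_tangent_interval:
  assumes "is_interval I" "\<exists>u\<in>I. \<exists>v\<in>I. u < v" "(s::real) \<in> I"
  shows "1 \<in> tangent_space I s"
proof -
  obtain \<sigma> \<epsilon> where \<sigma>: "\<sigma> \<in> {1, -1}" "\<epsilon> > 0" "\<And>t. 0 \<le> t \<Longrightarrow> t < \<epsilon> \<Longrightarrow> s + \<sigma> * t \<in> I"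
    by (rule interval_inward_direction[OF assms(1,2) \<open>s \<in> I\<close>]) blast
  have "\<sigma> \<in> tangent_space I s"
    by (rule tangent_spaceI[where c = "\<lambda>t. s + \<sigma> * t", OF \<sigma>(2) _ \<sigma>(3)])
      (auto intro!: derivative_eq_intros simp: has_real_derivative_iff_has_vector_derivative[symmetric])
  then have "\<sigma> *\<^sub>R \<sigma> \<in> tangent_space I s" by (rule subspace_scale[OF subspace_tangent_space])
  then show ?thesis using \<sigma>(1) by auto
qed

lemma tangent_space_L_dom:
  assumes "is_interval I" "\<exists>u\<in>I. \<exists>v\<in>I. u < v" "norm (x :: real ^ 'n) = 1" "s \<in> I"
  shows "tangent_space (L_dom I) (x, s) = {(z, b). z \<bullet> x = 0}"
proof -
  obtain \<sigma> \<epsilon> where \<sigma>: "\<sigma> \<in> {1, -1}" "\<epsilon> > 0" "\<And>t. 0 \<le> t \<Longrightarrow> t < \<epsilon> \<Longrightarrow> s + \<sigma> * t \<in> I"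
    by (rule interval_inward_direction[OF assms(1,2) \<open>s \<in> I\<close>]) blast
  have "(0, \<sigma>) \<in> tangent_space (L_dom I) (x, s)"
  proof (rule tangent_spaceI[where c = "\<lambda>t. (x, s + \<sigma> * t)", OF \<sigma>(2)])
    have "((\<lambda>t. s + \<sigma> * t) has_vector_derivative \<sigma>) (at 0)"
      by (auto intro!: derivative_eq_intros simp: has_real_derivative_iff_has_vector_derivative[symmetric])
    then show "((\<lambda>t. (x, s + \<sigma> * t)) has_vector_derivative (0, \<sigma>)) (at 0)"
      by (intro has_vector_derivative_Pair has_vector_derivative_const)
  qed (use assms(3) \<sigma>(3) in \<open>auto simp: L_dom_def\<close>)
  then have "(b * \<sigma>) *\<^sub>R (0, \<sigma>) \<in> tangent_space (L_dom I) (x, s)" for b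
    by (rule subspace_scale[OF subspace_tangent_space])
  moreover have "b * \<sigma> * \<sigma> = b" for b using \<sigma>(1) by auto
  ultimately have "(0, b) \<in> tangent_space (L_dom I) (x, s)" for b by simp
  then have "(z, b) \<in> tangent_space (L_dom I) (x, s)" if "z \<bullet> x = 0" for z b
    using subspace_add[OF subspace_tangent_space sphere_direction_tangent[OF that assms(3,4)],
        of "(0, b)"] by simp
  then show ?thesis using tangent_space_L_dom_constraint[OF _ assms(3,4)] by fast
qed

lemma dim_span_orthogonal_family:
  fixes f :: "nat \<Rightarrow> 'a::euclidean_space"
  assumes "\<And>i j. i < m \<Longrightarrow> j < m \<Longrightarrow> f i \<bullet> f j = (if i = j then r else 0)" "r \<noteq> 0"
  shows "dim (span (f ` {..<m})) = m"
proof -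
  have inj: "inj_on f {..<m}"
  proof (rule inj_onI)
    fix i j assume "i \<in> {..<m}" "j \<in> {..<m}" "f i = f j"
    then show "i = j" using assms(1)[of i i] assms(1)[of i j] assms(2) by (auto split: if_splits)
  qed
  have "pairwise orthogonal (f ` {..<m})" "0 \<notin> f ` {..<m}"
  proof -
    show "pairwise orthogonal (f ` {..<m})"
      by (rule pairwise_imageI) (use assms(1) in \<open>auto simp: orthogonal_def\<close>)
    have "f i \<noteq> 0" if "i < m" for i using assms(1)[OF that that] assms(2) by auto
    then show "0 \<notin> f ` {..<m}" by force
  qed
  then have "independent (f ` {..<m})" by (rule pairwise_orthogonal_independent)
  then show ?thesis by (simp add: dim_eq_card_independent card_image[OF inj])
qed

lemma dim_orthogonal_complement_unit:
  assumes "norm (x :: real ^ 'n) = 1"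
  shows "dim {z. z \<bullet> x = 0} = CARD('n) - 1"
proof -
  have "x \<noteq> 0" using assms by auto
  then show ?thesis using dim_hyperplane[of x] by (simp add: inner_commute)
qed

lemma orthonormal_basis_complement:
  assumes "norm (x :: real ^ 'n) = 1"
  obtains b where "\<And>i. i < CARD('n) - 1 \<Longrightarrow> b i \<bullet> x = 0"
    "\<And>i j. i < CARD('n) - 1 \<Longrightarrow> j < CARD('n) - 1 \<Longrightarrow> b i \<bullet> b j = (if i = j then 1 else 0)"
proof -
  have "subspace {z. z \<bullet> x = 0}" using subspace_hyperplane[of x] by (simp add: inner_commute)
  then obtain B where "B \<subseteq> {z. z \<bullet> x = 0}" "pairwise orthogonal B" "\<And>z. z \<in> B \<Longrightarrow> norm z = 1"
    "independent B" "card B = dim {z. z \<bullet> x = 0}"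
    by (rule orthonormal_basis_subspace) blast
  then have B: "B \<subseteq> {z. z \<bullet> x = 0}" "pairwise orthogonal B" "\<And>z. z \<in> B \<Longrightarrow> norm z = 1"
    "independent B" "card B = CARD('n) - 1"
    by (simp_all add: dim_orthogonal_complement_unit[OF assms])
  obtain b where b: "bij_betw b {0..<card B} B"
    using ex_bij_betw_nat_finite independent_imp_finite B(4) by blast
  have bB: "b i \<in> B" if "i < card B" for i using b that bij_betwE by fastforce
  show thesis
  proof (rule that[of b])
    fix i j assume ij: "i < CARD('n) - 1" "j < CARD('n) - 1"
    show "b i \<bullet> b j = (if i = j then 1 else 0)"
    proof (cases "i = j")
      case True then show ?thesis using B(3) bB ij(1) B(5) by (simp add: dot_square_norm)
    next
      case False
      then have "b i \<noteq> b j" using b ij B(5) by (auto simp: bij_betw_def inj_on_def)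
      then show ?thesis using False B(2) bB ij B(5) by (auto simp: pairwise_def orthogonal_def)
    qed
  qed (use B bB in auto)
qed

section \<open>Levi-Civita connection of a warped product metric\<close>

text \<open>A derivative within \<open>I\<close> is the differential applied to the unit vector field on \<open>I\<close>.\<close>

lemma smooth_on_interval_derivative:
  fixes I :: "real set"
  assumes I: "is_interval I" "\<exists>u\<in>I. \<exists>v\<in>I. u < v"
    and "smooth_on I B" "\<And>s. s \<in> I \<Longrightarrow> (B has_vector_derivative B' s) (at s within I)"
  shows "smooth_on I B'"
proof (rule smooth_on_cong)
  show "smooth_on I (\<lambda>s. differential I B s 1)"
    by (rule smooth_on_differential[OF assms(3) smooth_on_const unit_tangent_interval[OF I]])
  show "differential I B s 1 = B' s" if "s \<in> I" for s
    using differential_eq[OF assms(4)[OF that, unfolded has_vector_derivative_def]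
        unit_tangent_interval[OF I that]] by simp
qed

text \<open>A metric need only be prescribed on tangent vectors, so \<open>g\<close> is a parameter constrained there and
  arbitrary elsewhere.\<close>

locale warped_cylinder =
  fixes I :: "real set" and A A' C C' :: "real \<Rightarrow> real"
    and g :: "(real ^ 'n) \<times> real \<Rightarrow> (real ^ 'n) \<times> real \<Rightarrow> (real ^ 'n) \<times> real \<Rightarrow> real"
  assumes I: "is_interval I" "\<exists>u\<in>I. \<exists>v\<in>I. u < v"
    and smooth: "smooth_on I A" "smooth_on I C"
    and pos: "\<And>s. s \<in> I \<Longrightarrow> A s > 0" "\<And>s. s \<in> I \<Longrightarrow> C s > 0"
    and deriv: "\<And>s. s \<in> I \<Longrightarrow> (A has_real_derivative A' s) (at s within I)"
      "\<And>s. s \<in> I \<Longrightarrow> (C has_real_derivative C' s) (at s within I)"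
    and g_eq: "\<And>x s u a v b. norm x = 1 \<Longrightarrow> s \<in> I \<Longrightarrow> u \<bullet> x = 0 \<Longrightarrow> v \<bullet> x = 0 \<Longrightarrow>
      g (x, s) (u, a) (v, b) = A s * (u \<bullet> v) + C s * (a * b)"
begin

abbreviation cyl :: "((real ^ 'n) \<times> real) set" where
  "cyl \<equiv> L_dom I"

lemma tangent_cyl:
  assumes "p \<in> cyl" "open U" "p \<in> U"
  shows "v \<in> tangent_space (cyl \<inter> U) p \<longleftrightarrow> fst v \<bullet> fst p = 0"
  using assms tangent_space_L_dom[OF I, of "fst p" "snd p"]
  by (cases p; cases v) (auto simp: tangent_space_Int_open L_dom_def)

lemma g_tangent:
  assumes "p \<in> cyl" "fst u \<bullet> fst p = 0" "fst v \<bullet> fst p = 0"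
  shows "g p u v = A (snd p) * (fst u \<bullet> fst v) + C (snd p) * (snd u * snd v)"
  using assms g_eq[of "fst p" "snd p" "fst u" "fst v" "snd u" "snd v"]
  by (auto simp: L_dom_def)

text \<open>The correction to the ambient derivative \<open>D\<^sub>X Y\<close>. Projecting \<open>D\<^sub>X Y\<close> to the sphere adds the radial
  multiple of \<open>fst p\<close>; the other terms are the Christoffel symbols of the warped product metric.\<close>

definition christoffel where
  "christoffel p v w =
     ((fst v \<bullet> fst w) *\<^sub>R fst p
        + (A' (snd p) * inverse (2 * A (snd p))) *\<^sub>R (snd v *\<^sub>R fst w + snd w *\<^sub>R fst v),
      C' (snd p) * inverse (2 * C (snd p)) * (snd v * snd w)
        - A' (snd p) * inverse (2 * C (snd p)) * (fst v \<bullet> fst w))"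

definition connection where
  "connection S X Y p = differential S Y p (X p) + christoffel p (X p) (Y p)"

lemma christoffel_commute: "christoffel p v w = christoffel p w v"
  by (simp add: christoffel_def inner_commute add.commute mult.commute)

lemma christoffel_add: "christoffel p (v + v') w = christoffel p v w + christoffel p v' w"
  by (simp add: christoffel_def algebra_simps inner_add scaleR_add_left add_divide_distrib)

lemma christoffel_scaleR: "christoffel p (r *\<^sub>R v) w = r *\<^sub>R christoffel p v w"
  by (simp add: christoffel_def algebra_simps)

text \<open>Compatibility with the metric, reduced to pointwise algebra. The radial multiple of \<open>fst p\<close> is
  subtracted because it is orthogonal to tangent vectors; without it the identity holds for all
  vectors. The cross terms cancel because the factors \<open>A' / (2 A)\<close> and \<open>A' / (2 C)\<close> become equal
  after multiplication by \<open>A\<close> and \<open>C\<close>.\<close>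

lemma christoffel_metric:
  assumes "snd p \<in> I"
  shows "A' (snd p) * snd u * (fst v \<bullet> fst w) + C' (snd p) * snd u * (snd v * snd w)
    = A (snd p) * ((fst (christoffel p u v) - (fst u \<bullet> fst v) *\<^sub>R fst p) \<bullet> fst w)
      + C (snd p) * (snd (christoffel p u v) * snd w)
      + A (snd p) * (fst v \<bullet> (fst (christoffel p u w) - (fst u \<bullet> fst w) *\<^sub>R fst p))
      + C (snd p) * (snd v * snd (christoffel p u w))"
  using pos[OF assms] by (simp add: christoffel_def field_simps inner_add inner_commute)

context
  fixes U :: "((real ^ 'n) \<times> real) set"
  assumes U: "open U"
begin

abbreviation "patch \<equiv> cyl \<inter> U"

lemma field_has_derivative:
  "X \<in> vector_fields patch \<Longrightarrow> p \<in> patch \<Longrightarrow>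
    (X has_derivative differential patch X p) (at p within patch)"
  by (simp add: vector_fields_def has_derivative_differential)

lemma field_orthogonal: "X \<in> vector_fields patch \<Longrightarrow> p \<in> patch \<Longrightarrow> fst (X p) \<bullet> fst p = 0"
  using tangent_cyl[OF _ U] by (auto simp: vector_fields_def)

lemma vector_fieldI:
  "smooth_on patch X \<Longrightarrow> (\<And>p. p \<in> patch \<Longrightarrow> fst (X p) \<bullet> fst p = 0) \<Longrightarrow> X \<in> vector_fields patch"
  using tangent_cyl[OF _ U] by (auto simp: vector_fields_def)

lemma field_tangent: "X \<in> vector_fields patch \<Longrightarrow> p \<in> patch \<Longrightarrow> X p \<in> tangent_space patch p"
  by (simp add: vector_fields_def)

lemma field_smooth: "X \<in> vector_fields patch \<Longrightarrow> smooth_on patch X"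
  by (simp add: vector_fields_def)

text \<open>Differentiate \<open>fst (Y q) \<bullet> fst q = 0\<close> along \<open>v\<close>.\<close>

lemma differential_field_orthogonal:
  assumes Y: "Y \<in> vector_fields patch" and p: "p \<in> patch" and v: "v \<in> tangent_space patch p"
  shows "fst (differential patch Y p v) \<bullet> fst p = - (fst v \<bullet> fst (Y p))"
proof -
  have "((\<lambda>q. fst (Y q) \<bullet> fst q) has_derivative
      (\<lambda>v. fst (Y p) \<bullet> fst v + fst (differential patch Y p v) \<bullet> fst p)) (at p within patch)"
    by (intro has_derivative_inner has_derivative_fst field_has_derivative[OF Y p] has_derivative_ident)
  from has_derivative_constant_on[OF this p field_orthogonal[OF Y] v] show ?thesis
    by (simp add: inner_commute)
qed

lemma has_derivative_height:
  assumes "p \<in> patch" "(B has_real_derivative B') (at (snd p) within I)"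
  shows "((\<lambda>q. B (snd q)) has_derivative (\<lambda>v. B' * snd v)) (at p within patch)"
proof (rule has_derivative_in_compose[OF has_derivative_snd[OF has_derivative_ident]])
  show "(B has_derivative (*) B') (at (snd p) within snd ` patch)"
    by (rule has_derivative_subset[OF assms(2)[unfolded has_field_derivative_def]])
      (auto simp: L_dom_def)
qed

lemma differential_metric:
  assumes Y: "Y \<in> vector_fields patch" and Z: "Z \<in> vector_fields patch"
    and p: "p \<in> patch" and v: "v \<in> tangent_space patch p"
  shows "differential patch (\<lambda>q. g q (Y q) (Z q)) p v =
    A' (snd p) * snd v * (fst (Y p) \<bullet> fst (Z p))
    + A (snd p) * (fst (Y p) \<bullet> fst (differential patch Z p v)
        + fst (differential patch Y p v) \<bullet> fst (Z p))
    + C' (snd p) * snd v * (snd (Y p) * snd (Z p))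
    + C (snd p) * (snd (Y p) * snd (differential patch Z p v)
        + snd (differential patch Y p v) * snd (Z p))" (is "_ = ?D v")
proof (rule differential_eq[OF _ v])
  note dY = field_has_derivative[OF Y p] and dZ = field_has_derivative[OF Z p]
  have s: "snd p \<in> I" using p by (auto simp: L_dom_def)
  have "((\<lambda>q. A (snd q) * (fst (Y q) \<bullet> fst (Z q)) + C (snd q) * (snd (Y q) * snd (Z q)))
    has_derivative (\<lambda>v. A (snd p) * (fst (Y p) \<bullet> fst (differential patch Z p v)
        + fst (differential patch Y p v) \<bullet> fst (Z p)) + A' (snd p) * snd v * (fst (Y p) \<bullet> fst (Z p))
      + (C (snd p) * (snd (Y p) * snd (differential patch Z p v)
        + snd (differential patch Y p v) * snd (Z p)) + C' (snd p) * snd v * (snd (Y p) * snd (Z p)))))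
    (at p within patch)"
    by (intro has_derivative_add has_derivative_mult has_derivative_height[OF p] deriv[OF s]
        has_derivative_inner has_derivative_fst has_derivative_snd dY dZ)
  then have "((\<lambda>q. A (snd q) * (fst (Y q) \<bullet> fst (Z q)) + C (snd q) * (snd (Y q) * snd (Z q)))
    has_derivative ?D) (at p within patch)"
    by (rule has_derivative_eq_rhs) (simp add: fun_eq_iff)
  then show "((\<lambda>q. g q (Y q) (Z q)) has_derivative ?D) (at p within patch)"
    by (rule has_derivative_transform[OF p, rotated])
      (use g_tangent field_orthogonal[OF Y] field_orthogonal[OF Z] in auto)
qed

text \<open>The radial term in \<open>christoffel\<close> cancels the radial part of \<open>D\<^sub>X Y\<close> given by
  \<open>differential_field_orthogonal\<close>.\<close>

lemma connection_vector_field: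
  assumes X: "X \<in> vector_fields patch" and Y: "Y \<in> vector_fields patch"
  shows "connection patch X Y \<in> vector_fields patch"
proof (rule vector_fieldI)
  have h: "smooth_on patch (\<lambda>p. B (snd p))" if "smooth_on I B" for B :: "real \<Rightarrow> real"
    by (rule smooth_on_compose_linear[OF bounded_linear_snd that]) (auto simp: L_dom_def)
  have inv: "smooth_on patch (\<lambda>p. inverse (2 * B (snd p)))"
    if "smooth_on I B" "\<And>s. s \<in> I \<Longrightarrow> B s > 0" for B :: "real \<Rightarrow> real"
    by (intro smooth_on_inverse smooth_on_mult smooth_on_const h that(1))
      (use that(2) in \<open>force simp: L_dom_def\<close>)
  note A = smooth_on_interval_derivative[OF I smooth(1)
      deriv(1)[unfolded has_real_derivative_iff_has_vector_derivative]]
    and C = smooth_on_interval_derivative[OF I smooth(2)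
      deriv(2)[unfolded has_real_derivative_iff_has_vector_derivative]]
  note x = field_smooth[OF X] and y = field_smooth[OF Y]
  have chr: "smooth_on patch (\<lambda>p. christoffel p (X p) (Y p))"
    unfolding christoffel_def
    by (intro smooth_on_Pair smooth_on_add smooth_on_diff smooth_on_scaleR smooth_on_mult
        smooth_on_inner smooth_on_fst smooth_on_snd smooth_on_ident x y h[OF A] h[OF C]
        inv[OF smooth(1) pos(1)] inv[OF smooth(2) pos(2)])
  show "smooth_on patch (connection patch X Y)"
    unfolding connection_def
    by (intro smooth_on_add smooth_on_differential y x field_tangent[OF X] chr)
  show "fst (connection patch X Y p) \<bullet> fst p = 0" if p: "p \<in> patch" for p
  proof -
    have "fst p \<bullet> fst p = 1" using p by (auto simp: L_dom_def norm_eq_1)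
    then show ?thesis
      using differential_field_orthogonal[OF Y p field_tangent[OF X p]]
        field_orthogonal[OF X p] field_orthogonal[OF Y p]
      by (simp add: connection_def christoffel_def inner_add)
  qed
qed

text \<open>Torsion-freeness is the symmetry of \<open>christoffel\<close>, and metric compatibility combines
  \<open>differential_metric\<close> with \<open>christoffel_metric\<close>.\<close>

lemma levi_civita_connection: "levi_civita patch g (connection patch)"
  unfolding levi_civita_def affine_connection_def
proof (intro conjI ballI allI impI)
  fix X Y p assume X: "X \<in> vector_fields patch" and Y: "Y \<in> vector_fields patch" and p: "p \<in> patch"
  note dY = field_has_derivative[OF Y p] and Xp = field_tangent[OF X p]
  have lin: "linear (differential patch Y p)" using dY has_derivative_linear by blast
  show "connection patch (\<lambda>q. X q + X' q) Y p = connection patch X Y p + connection patch X' Y p" for X'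
    by (simp add: connection_def christoffel_add linear_add[OF lin])
  show "connection patch (\<lambda>q. \<phi> q *\<^sub>R X q) Y p = \<phi> p *\<^sub>R connection patch X Y p" for \<phi>
    by (simp add: connection_def christoffel_scaleR linear_cmul[OF lin] scaleR_add_right)
  show "connection patch X (\<lambda>q. Y q + Y' q) p = connection patch X Y p + connection patch X Y' p"
    if Y': "Y' \<in> vector_fields patch" for Y'
    using differential_eq[OF has_derivative_add[OF dY field_has_derivative[OF Y' p]] Xp]
    by (simp add: connection_def christoffel_commute[of p "X p"] christoffel_add)
  show "connection patch X (\<lambda>q. \<phi> q *\<^sub>R Y q) p =
      differential patch \<phi> p (X p) *\<^sub>R Y p + \<phi> p *\<^sub>R connection patch X Y p"
    if \<phi>: "smooth_on patch \<phi>" for \<phi>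
    using differential_eq[OF has_derivative_scaleR[OF has_derivative_differential[OF \<phi> p] dY] Xp]
    by (simp add: connection_def christoffel_commute[of p "X p"] christoffel_scaleR scaleR_add_right)
  show "connection patch X Y p - connection patch Y X p = lie_bracket patch X Y p"
    by (simp add: connection_def lie_bracket_def christoffel_commute[of p "X p"])
  show "differential patch (\<lambda>q. g q (Y q) (Z q)) p (X p) =
      g p (connection patch X Y p) (Z p) + g p (Y p) (connection patch X Z p)"
    if Z: "Z \<in> vector_fields patch" for Z
  proof -
    have pc: "p \<in> cyl" "snd p \<in> I" using p by (auto simp: L_dom_def)
    note o = field_orthogonal[OF _ p]
    have 1: "g p (connection patch X Y p) (Z p) =
        A (snd p) * (fst (connection patch X Y p) \<bullet> fst (Z p))
        + C (snd p) * (snd (connection patch X Y p) * snd (Z p))"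
      by (rule g_tangent[OF pc(1) o[OF connection_vector_field[OF X Y]] o[OF Z]])
    have 2: "g p (Y p) (connection patch X Z p) =
        A (snd p) * (fst (Y p) \<bullet> fst (connection patch X Z p))
        + C (snd p) * (snd (Y p) * snd (connection patch X Z p))"
      by (rule g_tangent[OF pc(1) o[OF Y] o[OF connection_vector_field[OF X Z]]])
    have 3: "fst p \<bullet> fst (Z p) = 0" "fst (Y p) \<bullet> fst p = 0" "fst p \<bullet> fst (Y p) = 0"
      using o[OF Y] o[OF Z] by (auto simp: inner_commute)
    show ?thesis
      unfolding 1 2 differential_metric[OF Y Z p Xp]
      using christoffel_metric[OF pc(2), of "X p" "Y p" "Z p"] 3
      by (simp add: connection_def inner_add inner_diff algebra_simps)
  qed
qed (rule connection_vector_field)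

end

end

section \<open>Mean curvature of the slices\<close>

lemma levi_civita_closed:
  assumes "levi_civita N g nabla" "X \<in> vector_fields N" "Y \<in> vector_fields N"
  shows "nabla X Y \<in> vector_fields N"
proof -
  have "\<forall>X\<in>vector_fields N. \<forall>Y\<in>vector_fields N. nabla X Y \<in> vector_fields N"
    using assms(1) unfolding levi_civita_def affine_connection_def by (elim conjE)
  then show ?thesis using assms(2,3) by simp
qed

context warped_cylinder
begin

text \<open>The metric has no mixed term, so the normal line of a slice is spanned by \<open>(0, 1)\<close>.\<close>

lemma normal_part_cyl:
  assumes x: "norm x = 1" and s: "s \<in> I" and v: "fst v \<bullet> x = 0"
  shows "normal_part cyl g (L_dom {s}) (x, s) v = (0, snd v)"
  unfolding normal_part_def tangent_space_L_dom_singleton[OF x] tangent_space_L_dom[OF I x s]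
proof (rule the_equality)
  show "(0, snd v) \<in> {(z, b). z \<bullet> x = 0} \<and> v - (0, snd v) \<in> {(z, b). z \<bullet> x = 0 \<and> b = 0} \<and>
      (\<forall>z\<in>{(z, b). z \<bullet> x = 0 \<and> b = 0}. g (x, s) (0, snd v) z = 0)"
    using v by (cases v) (auto simp: g_eq[OF x s])
next
  fix u assume u: "u \<in> {(z, b). z \<bullet> x = 0} \<and> v - u \<in> {(z, b). z \<bullet> x = 0 \<and> b = 0} \<and>
      (\<forall>z\<in>{(z, b). z \<bullet> x = 0 \<and> b = 0}. g (x, s) u z = 0)"
  obtain y b where yb: "u = (y, b)" by (cases u)
  have "y \<bullet> x = 0" "b = snd v" using u by (cases v; auto simp: yb)+
  moreover have "g (x, s) (y, b) (y, 0) = 0" using u \<open>y \<bullet> x = 0\<close> by (auto simp: yb)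
  ultimately show "u = (0, snd v)" using g_eq[OF x s] pos(1)[OF s] by (simp add: yb)
qed

text \<open>Only the axioms of \<open>nabla\<close> enter, which makes the value independent of the connection and of the
  extension of the frame fields off the slice. \<open>T\<close> is the coordinate field \<open>\<partial>/\<partial>s\<close>.\<close>

lemma slice_second_fundamental_form:
  assumes U: "open U" "(x, s) \<in> U" and x: "norm x = 1" and s: "s \<in> I"
    and lc: "levi_civita (cyl \<inter> U) g nabla"
    and e: "e \<in> vector_fields (cyl \<inter> U)"
    and slice: "\<And>q. q \<in> L_dom {s} \<inter> U \<Longrightarrow> snd (e q) = 0"
  shows "C s * snd (nabla e e (x, s)) = - (A' s / 2) * (fst (e (x, s)) \<bullet> fst (e (x, s)))"
proof -
  let ?N = "cyl \<inter> U" and ?p = "(x, s)"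
  define T :: "(real ^ 'n) \<times> real \<Rightarrow> (real ^ 'n) \<times> real" where "T = (\<lambda>_. (0, 1))"
  have p: "?p \<in> ?N" "?p \<in> cyl" using U x s by (auto simp: L_dom_def)
  have T: "T \<in> vector_fields ?N"
    by (rule vector_fieldI[OF U(1)]) (simp_all add: T_def smooth_on_const)
  note closed = levi_civita_closed[OF lc]
  have compat: "differential ?N (\<lambda>q. g q (Y q) (Z q)) ?p (X ?p) =
      g ?p (nabla X Y ?p) (Z ?p) + g ?p (Y ?p) (nabla X Z ?p)"
    if "X \<in> vector_fields ?N" "Y \<in> vector_fields ?N" "Z \<in> vector_fields ?N" for X Y Z
    using lc that p(1) unfolding levi_civita_def by blast
  have torsion: "nabla e T ?p - nabla T e ?p = lie_bracket ?N e T ?p"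
    using lc e T p(1) unfolding levi_civita_def by blast
  note tan = field_tangent[OF U(1) _ p(1)] and orth = field_orthogonal[OF U(1) _ p(1)]
  have g: "g ?p (X ?p) (Y ?p) = A s * (fst (X ?p) \<bullet> fst (Y ?p)) + C s * (snd (X ?p) * snd (Y ?p))"
    if "X \<in> vector_fields ?N" "Y \<in> vector_fields ?N" for X Y
    using g_tangent[OF p(2) orth[OF that(1)] orth[OF that(2)]] by simp
  have DT: "differential ?N T ?p v = 0" if "v \<in> tangent_space ?N ?p" for v
    using differential_eq[OF _ that, of T "\<lambda>_. 0"] by (simp add: T_def)
  let ?De = "differential ?N e ?p"
  have se: "snd (e ?p) = 0" using slice[of ?p] U x by (simp add: L_dom_def)
  have slice_tan: "e ?p \<in> tangent_space (L_dom {s} \<inter> U) ?p"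
    using orth[OF e] se
    by (cases "e ?p") (simp add: tangent_space_Int_open[OF U] tangent_space_L_dom_singleton[OF x])
  have "(e has_derivative ?De) (at ?p within L_dom {s} \<inter> U)"
    by (rule has_derivative_subset[OF field_has_derivative[OF U(1) e p(1)]])
      (use s in \<open>auto simp: L_dom_def\<close>)
  from has_derivative_constant_on[OF has_derivative_snd[OF this] _ slice slice_tan]
  have sDe: "snd (?De (e ?p)) = 0" using U x by (simp add: L_dom_def)
  \<comment> \<open>\<open>g(e, T)\<close> vanishes along the slice, to which \<open>e\<close> is tangent.\<close>
  have "differential ?N (\<lambda>q. g q (e q) (T q)) ?p (e ?p) = 0"
    unfolding differential_metric[OF U(1) e T p(1) tan[OF e]] DT[OF tan[OF e]]
    using se sDe by (simp add: T_def)
  then have "g ?p (nabla e e ?p) (T ?p) + g ?p (e ?p) (nabla e T ?p) = 0"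
    using compat[OF e e T] by simp
  then have 1: "C s * snd (nabla e e ?p) = - (A s * (fst (e ?p) \<bullet> fst (nabla e T ?p)))"
    using g[OF closed[OF e e] T] g[OF e closed[OF e T]] se by (simp add: T_def)
  \<comment> \<open>The bracket of \<open>e\<close> with the constant field \<open>T\<close> is \<open>- D\<^sub>T e\<close>.\<close>
  have 2: "nabla e T ?p = nabla T e ?p - ?De (T ?p)"
    using torsion DT[OF tan[OF e]] by (simp add: lie_bracket_def algebra_simps)
  have "differential ?N (\<lambda>q. g q (e q) (e q)) ?p (T ?p)
      = A' s * (fst (e ?p) \<bullet> fst (e ?p)) + 2 * (A s * (fst (e ?p) \<bullet> fst (?De (T ?p))))"
    unfolding differential_metric[OF U(1) e e p(1) tan[OF T]]
    using se by (simp add: T_def inner_commute)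
  then have "A' s * (fst (e ?p) \<bullet> fst (e ?p)) + 2 * (A s * (fst (e ?p) \<bullet> fst (?De (T ?p))))
      = 2 * (A s * (fst (e ?p) \<bullet> fst (nabla T e ?p)))"
    using compat[OF T e e] g[OF closed[OF T e] e] g[OF e closed[OF T e]] se
    by (simp add: inner_commute)
  then show ?thesis
    unfolding 1 2 by (simp add: inner_diff_right algebra_simps)
qed

text \<open>The first components of the frame at the base point form an orthogonal basis of the complement of
  \<open>x\<close>. Hence the length of a frame is forced.\<close>

lemma slice_frame_properties:
  assumes U: "open U" "(x, s) \<in> U" and x: "norm x = 1" and s: "s \<in> I"
    and fields: "\<forall>j<m. e j \<in> vector_fields (cyl \<inter> U)"
    and frame: "orthonormal_frame_on g (L_dom {s}) U m e"
  shows "m = CARD('n) - 1"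
    and "\<And>j q. j < m \<Longrightarrow> q \<in> L_dom {s} \<inter> U \<Longrightarrow> snd (e j q) = 0"
    and "\<And>j. j < m \<Longrightarrow> fst (e j (x, s)) \<bullet> fst (e j (x, s)) = inverse (A s)"
proof -
  note e = fields[rule_format]
  have span: "span ((\<lambda>j. e j q) ` {..<m}) = tangent_space (L_dom {s}) q"
    and ortho: "\<And>i j. i < m \<Longrightarrow> j < m \<Longrightarrow> g q (e i q) (e j q) = (if i = j then 1 else 0)"
    if "q \<in> L_dom {s} \<inter> U" for q
    using frame that unfolding orthonormal_frame_on_def by blast+
  have tan: "e j q \<in> tangent_space (L_dom {s}) q" if "j < m" "q \<in> L_dom {s} \<inter> U" for j q
    unfolding span[OF that(2), symmetric] using that(1) by (intro span_base) auto
  show snd0: "snd (e j q) = 0" if "j < m" "q \<in> L_dom {s} \<inter> U" for j q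
    using tan[OF that] that(2) tangent_space_L_dom_singleton[of "fst q" s]
    by (cases "e j q") (auto simp: L_dom_def)
  have p: "(x, s) \<in> L_dom {s} \<inter> U" "(x, s) \<in> cyl \<inter> U" using U x s by (auto simp: L_dom_def)
  have inner: "fst (e i (x, s)) \<bullet> fst (e j (x, s)) = (if i = j then inverse (A s) else 0)"
    if "i < m" "j < m" for i j
  proof -
    have "A s * (fst (e i (x, s)) \<bullet> fst (e j (x, s))) = (if i = j then 1 else 0)"
      using ortho[OF p(1) that] snd0[OF that(1) p(1)]
        g_tangent[OF _ field_orthogonal[OF U(1) e[OF that(1)] p(2)]
          field_orthogonal[OF U(1) e[OF that(2)] p(2)]] p(2)
      by simp
    then show ?thesis using pos(1)[OF s] by (auto simp: field_simps split: if_splits)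
  qed
  then show "fst (e j (x, s)) \<bullet> fst (e j (x, s)) = inverse (A s)" if "j < m" for j
    using that by simp
  have "fst ` tangent_space (L_dom {s}) (x, s) = {z. z \<bullet> x = 0}"
    unfolding tangent_space_L_dom_singleton[OF x] by force
  then have "span ((\<lambda>j. fst (e j (x, s))) ` {..<m}) = {z. z \<bullet> x = 0}"
    unfolding span[OF p(1), symmetric]
      linear_span_image[OF bounded_linear.linear[OF bounded_linear_fst], symmetric]
    by (simp add: image_image)
  then show "m = CARD('n) - 1"
    using dim_span_orthogonal_family[of m "\<lambda>j. fst (e j (x, s))", OF inner]
      dim_orthogonal_complement_unit[OF x] pos(1)[OF s] by simp
qed

text \<open>The reflection in the hyperplane orthogonal to \<open>y + x\<close> takes \<open>- x\<close> to \<open>y\<close>, hence maps the complement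
  of \<open>x\<close> isometrically onto that of \<open>y\<close>. Reflecting \<open>- x\<close> rather than \<open>x\<close> makes it depend smoothly on
  \<open>y\<close> near \<open>x\<close>: the denominator \<open>1 + x \<bullet> y\<close> vanishes on the sphere only at
  \<open>y = - x\<close>.\<close>

lemma slice_frame_exists:
  assumes x: "norm x = 1" and s: "s \<in> I"
  obtains U and e :: "nat \<Rightarrow> (real ^ 'n) \<times> real \<Rightarrow> (real ^ 'n) \<times> real" where "open U" "(x, s) \<in> U"
    "\<And>j. j < CARD('n) - 1 \<Longrightarrow> e j \<in> vector_fields (cyl \<inter> U)"
    "orthonormal_frame_on g (L_dom {s}) U (CARD('n) - 1) e"
proof -
  let ?m = "CARD('n) - 1"
  obtain b where b: "\<And>i. i < ?m \<Longrightarrow> b i \<bullet> x = 0"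
    "\<And>i j. i < ?m \<Longrightarrow> j < ?m \<Longrightarrow> b i \<bullet> b j = (if i = j then 1 else 0)"
    by (rule orthonormal_basis_complement[OF x]) blast
  define U :: "((real ^ 'n) \<times> real) set" where "U = {q. 1 + x \<bullet> fst q > 0}"
  define v where "v j y = b j - ((b j \<bullet> y) * inverse (1 + x \<bullet> y)) *\<^sub>R (y + x)" for j and y :: "real ^ 'n"
  define e where "e j q = (inverse (sqrt (A s)) *\<^sub>R v j (fst q), 0 :: real)"
    for j and q :: "(real ^ 'n) \<times> real"
  have xx: "x \<bullet> x = 1" using x by (simp add: norm_eq_1)
  have U: "open U" "(x, s) \<in> U"
    unfolding U_def by (auto intro!: open_Collect_less continuous_intros simp: xx)
  have v_tan: "v j y \<bullet> y = 0" if "norm y = 1" "1 + x \<bullet> y > 0" for j y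
  proof -
    have "y \<bullet> y = 1" using that(1) by (simp add: norm_eq_1)
    then have "v j y \<bullet> y = b j \<bullet> y - (b j \<bullet> y) * (inverse (1 + x \<bullet> y) * (1 + x \<bullet> y))"
      by (simp add: v_def inner_diff inner_add)
    then show ?thesis using that(2) by simp
  qed
  have v_inner: "v i y \<bullet> v j y = (if i = j then 1 else 0)"
    if "i < ?m" "j < ?m" "norm y = 1" "1 + x \<bullet> y > 0" for i j y
  proof -
    define c where "c = 1 + x \<bullet> y"
    have c: "c \<noteq> 0" "x \<bullet> y = c - 1" "y \<bullet> x = c - 1" "y \<bullet> y = 1"
      using that by (auto simp: c_def norm_eq_1 inner_commute)
    define z where "z = y + x"
    have z: "z \<bullet> z = 2 * c" "b i \<bullet> z = b i \<bullet> y" "z \<bullet> b j = b j \<bullet> y"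
      using b(1)[OF that(1)] b(1)[OF that(2)] by (simp_all add: z_def inner_add c xx inner_commute)
    have "v i y \<bullet> v j y = b i \<bullet> b j
        - (b j \<bullet> y) * inverse c * (b i \<bullet> y) - (b i \<bullet> y) * inverse c * (b j \<bullet> y)
        + (b i \<bullet> y) * inverse c * ((b j \<bullet> y) * inverse c) * (2 * c)"
      unfolding v_def c_def[symmetric] z_def[symmetric] by (simp add: inner_diff z algebra_simps)
    then show ?thesis using c(1) b(2)[OF that(1,2)] by (simp add: field_simps)
  qed
  have field: "e j \<in> vector_fields (cyl \<inter> U)" for j
  proof (rule vector_fieldI[OF U(1)])
    show "smooth_on (cyl \<inter> U) (e j)"
      unfolding e_def v_def
      by (intro smooth_on_Pair smooth_on_const smooth_on_scaleR smooth_on_diff smooth_on_mult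
          smooth_on_inner smooth_on_inverse smooth_on_add smooth_on_fst smooth_on_ident)
        (auto simp: U_def)
  qed (use v_tan in \<open>auto simp: e_def U_def L_dom_def\<close>)
  have "orthonormal_frame_on g (L_dom {s}) U ?m e"
    unfolding orthonormal_frame_on_def
  proof (intro ballI conjI allI impI)
    fix q assume "q \<in> L_dom {s} \<inter> U"
    then obtain y where q: "q = (y, s)" and y: "norm y = 1" "1 + x \<bullet> y > 0"
      by (cases q) (auto simp: L_dom_def U_def)
    show "g q (e i q) (e j q) = (if i = j then 1 else 0)" if "i < ?m" "j < ?m" for i j
      using v_inner[OF that y] pos(1)[OF s] v_tan[OF y]
      by (simp add: q e_def g_eq[OF y(1) s] power_inverse flip: power2_eq_square)
    let ?S = "span ((\<lambda>j. e j q) ` {..<?m})"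
    show "?S = tangent_space (L_dom {s}) q"
    proof (rule subspace_dim_equal)
      show "?S \<subseteq> tangent_space (L_dom {s}) q"
        by (rule span_minimal[OF _ subspace_tangent_space])
          (use v_tan[OF y] in \<open>auto simp: q tangent_space_L_dom_singleton[OF y(1)] e_def\<close>)
      have "tangent_space (L_dom {s}) q = (\<lambda>z. (z, 0)) ` {z. z \<bullet> y = 0}"
        unfolding q tangent_space_L_dom_singleton[OF y(1)] by auto
      then have "dim (tangent_space (L_dom {s}) q) \<le> dim {z. z \<bullet> y = 0}"
        using dim_image_le[of "\<lambda>z. (z, 0 :: real)" "{z. z \<bullet> y = 0}"]
        by (simp add: bounded_linear.linear bounded_linear_Pair bounded_linear_ident bounded_linear_zero)
      also have "\<dots> = ?m" by (rule dim_orthogonal_complement_unit[OF y(1)])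
      also have "\<dots> = dim ?S"
        by (rule dim_span_orthogonal_family[symmetric, where r = "inverse (A s)"])
          (use v_inner[OF _ _ y] pos(1)[OF s] in \<open>auto simp: e_def q inner_Pair
            power_inverse simp flip: power2_eq_square inverse_mult_distrib\<close>)
      finally show "dim (tangent_space (L_dom {s}) q) \<le> dim ?S" .
    qed (simp_all add: subspace_tangent_space)
  qed
  with U field show thesis by (rule that)
qed

text \<open>Each frame vector contributes the same multiple of \<open>(0, 1)\<close>, whatever the neighbourhood, connection
  and frame; the explicit connection and frame show that admissible data exist.\<close>

lemma mean_curvature_slice:
  assumes x: "norm x = 1" and s: "s \<in> I"
  shows "mean_curvature_vector cyl g (L_dom {s}) (x, s) =
    (0, - ((real CARD('n) - 1) * A' s / (2 * A s * C s)))" (is "_ = ?H")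
proof -
  have sum: "(\<Sum>j<m. normal_part cyl g (L_dom {s}) (x, s) (nabla (e j) (e j) (x, s))) = ?H"
    if U: "open U" "(x, s) \<in> U" and lc: "levi_civita (cyl \<inter> U) g nabla"
      and e: "\<forall>j<m. e j \<in> vector_fields (cyl \<inter> U)"
      and fr: "orthonormal_frame_on g (L_dom {s}) U m e" for U nabla m e
  proof -
    note e' = e[rule_format] and frame = slice_frame_properties[OF U x s e fr]
    have p: "(x, s) \<in> cyl \<inter> U" using U x s by (auto simp: L_dom_def)
    have "normal_part cyl g (L_dom {s}) (x, s) (nabla (e j) (e j) (x, s)) = (0, - (A' s / (2 * A s * C s)))"
      if j: "j < m" for j
    proof -
      have "nabla (e j) (e j) \<in> vector_fields (cyl \<inter> U)"
        by (rule levi_civita_closed[OF lc e'[OF j] e'[OF j]])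
      then have "fst (nabla (e j) (e j) (x, s)) \<bullet> x = 0"
        using field_orthogonal[OF U(1) _ p] by simp
      moreover have "C s * snd (nabla (e j) (e j) (x, s)) = - (A' s / 2) * inverse (A s)"
        using slice_second_fundamental_form[OF U x s lc e'[OF j] frame(2)[OF j]] frame(3)[OF j]
        by simp
      ultimately show ?thesis
        using normal_part_cyl[OF x s] pos[OF s] by (simp add: field_simps)
    qed
    then have "(\<Sum>j<m. normal_part cyl g (L_dom {s}) (x, s) (nabla (e j) (e j) (x, s)))
        = real m *\<^sub>R (0, - (A' s / (2 * A s * C s)))"
      by (simp add: sum_constant_scaleR)
    also have "\<dots> = ?H" using frame(1) by (simp add: of_nat_diff)
    finally show ?thesis .
  qed
  show ?thesis
    unfolding mean_curvature_vector_def
  proof (rule the_equality)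
    obtain U e where Ue: "open U" "(x, s) \<in> U"
      "\<And>j. j < CARD('n) - 1 \<Longrightarrow> e j \<in> vector_fields (cyl \<inter> U)"
      "orthonormal_frame_on g (L_dom {s}) U (CARD('n) - 1) e"
      by (rule slice_frame_exists[OF x s]) blast
    show "\<exists>U nabla m e. open U \<and> (x, s) \<in> U \<and> levi_civita (cyl \<inter> U) g nabla \<and>
        (\<forall>j<m. e j \<in> vector_fields (cyl \<inter> U)) \<and> orthonormal_frame_on g (L_dom {s}) U m e \<and>
        ?H = (\<Sum>j<m. normal_part cyl g (L_dom {s}) (x, s) (nabla (e j) (e j) (x, s)))"
      using sum[OF Ue(1,2) levi_civita_connection[OF Ue(1)] _ Ue(4)] Ue levi_civita_connection[OF Ue(1)]
      by (intro exI[of _ U] exI[of _ "connection (cyl \<inter> U)"] exI[of _ "CARD('n) - 1"] exI[of _ e]) simp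
  next
    fix H
    assume "\<exists>U nabla m e. open U \<and> (x, s) \<in> U \<and> levi_civita (cyl \<inter> U) g nabla \<and>
        (\<forall>j<m. e j \<in> vector_fields (cyl \<inter> U)) \<and> orthonormal_frame_on g (L_dom {s}) U m e \<and>
        H = (\<Sum>j<m. normal_part cyl g (L_dom {s}) (x, s) (nabla (e j) (e j) (x, s)))"
    then show "H = ?H" using sum by (elim exE conjE) simp
  qed
qed

end

section \<open>The metric induced by a plane curve\<close>

text \<open>The immersion with the coefficient as a separate argument, which exposes its bilinearity.\<close>

definition scale_vec :: "real ^ 'n \<Rightarrow> complex \<Rightarrow> complex ^ 'n" where
  "scale_vec x c = (\<chi> j. complex_of_real (x $ j) * c)"

lemma L_map_eq: "L_map w q = scale_vec (fst q) (w (snd q))"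
  by (cases q) (simp add: L_map_def scale_vec_def)

lemma bounded_bilinear_scale_vec: "bounded_bilinear scale_vec"
  unfolding bilinear_conv_bounded_bilinear[symmetric] bilinear_def
  by (auto intro!: linearI simp: scale_vec_def vec_eq_iff algebra_simps
      scaleR_conv_of_real[where 'a = complex])

lemma inner_scale_vec: "scale_vec x c \<bullet> scale_vec y d = (x \<bullet> y) * (c \<bullet> d)"
  unfolding scale_vec_def inner_vec_def scaleR_conv_of_real[symmetric]
  by (simp add: sum_distrib_left sum_distrib_right mult_ac)

lemma L_map_has_derivative:
  assumes w: "(w has_vector_derivative d) (at s within I)"
  shows "(L_map w has_derivative (\<lambda>v. scale_vec x (snd v *\<^sub>R d) + scale_vec (fst v) (w s)))
    (at (x :: real ^ 'n, s) within L_dom I)"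
proof -
  have "((\<lambda>q. w (snd q)) has_derivative (\<lambda>v. snd v *\<^sub>R d)) (at (x, s) within L_dom I)"
  proof (rule has_derivative_in_compose[OF has_derivative_snd[OF has_derivative_ident]])
    have "(w has_derivative (\<lambda>h. h *\<^sub>R d)) (at s within snd ` (L_dom I :: ((real ^ 'n) \<times> real) set))"
      by (rule has_derivative_subset[OF w[unfolded has_vector_derivative_def]]) (auto simp: L_dom_def)
    then show "(w has_derivative (\<lambda>h. h *\<^sub>R d))
        (at (snd (x, s)) within snd ` (L_dom I :: ((real ^ 'n) \<times> real) set))" by simp
  qed
  from bounded_bilinear.FDERIV[OF bounded_bilinear_scale_vec has_derivative_fst[OF has_derivative_ident] this]
  show ?thesis unfolding L_map_eq[abs_def] by simp
qed

text \<open>In \<open>(z w + b x w') \<bullet> (z' w + b' x w')\<close> the mixed terms contain \<open>z \<bullet> x\<close> or \<open>z' \<bullet> x\<close> and vanish.\<close>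

lemma warped_cylinder_induced_metric:
  assumes I: "is_interval I" "\<exists>u\<in>I. \<exists>v\<in>I. u < v"
    and w: "smooth_on I w" "\<And>s. s \<in> I \<Longrightarrow> w s \<noteq> 0"
    and w': "\<And>s. s \<in> I \<Longrightarrow> (w has_vector_derivative w' s) (at s within I)"
      "\<And>s. s \<in> I \<Longrightarrow> w' s \<noteq> 0"
  shows "\<exists>C'. warped_cylinder I (\<lambda>s. (cmod (w s))\<^sup>2) (\<lambda>s. 2 * (w s \<bullet> w' s))
    (\<lambda>s. (cmod (w' s))\<^sup>2) C' (induced_metric (L_dom I) (L_map w :: (real ^ 'n) \<times> real \<Rightarrow> _))"
proof -
  have w'_smooth: "smooth_on I w'" by (rule smooth_on_interval_derivative[OF I w(1) w'(1)])
  define w'' where "w'' s = vector_derivative w' (at s within I)" for s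
  have w'': "(w' has_vector_derivative w'' s) (at s within I)" if "s \<in> I" for s
    unfolding w''_def using smooth_on_differentiable[OF w'_smooth that]
    by (simp add: vector_derivative_works[symmetric])
  have sq: "((\<lambda>s. (cmod (f s))\<^sup>2) has_real_derivative 2 * (f s \<bullet> d)) (at s within I)"
    if "(f has_vector_derivative d) (at s within I)" for f d s
    using bounded_bilinear.has_vector_derivative[OF bounded_bilinear_inner that that]
    by (simp add: has_real_derivative_iff_has_vector_derivative power2_norm_eq_inner inner_commute)
  have sq_smooth: "smooth_on I (\<lambda>s. (cmod (f s))\<^sup>2)" if "smooth_on I f" for f
    unfolding power2_norm_eq_inner by (intro smooth_on_inner that)
  have "warped_cylinder I (\<lambda>s. (cmod (w s))\<^sup>2) (\<lambda>s. 2 * (w s \<bullet> w' s))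
    (\<lambda>s. (cmod (w' s))\<^sup>2) (\<lambda>s. 2 * (w' s \<bullet> w'' s))
    (induced_metric (L_dom I) (L_map w :: (real ^ 'n) \<times> real \<Rightarrow> _))"
  proof
    fix x u v :: "real ^ 'n" and s a b :: real
    assume x: "norm x = 1" and s: "s \<in> I" and uv: "u \<bullet> x = 0" "v \<bullet> x = 0"
    have xx: "x \<bullet> x = 1" using x by (simp add: norm_eq_1)
    have d: "differential (L_dom I) (L_map w) (x, s) (z, c)
        = scale_vec x (c *\<^sub>R w' s) + scale_vec z (w s)" if "z \<bullet> x = 0" for z c
      using differential_eq[OF L_map_has_derivative[OF w'(1)[OF s]], of "(z, c)"] that
      by (simp add: tangent_space_L_dom[OF I x s])
    show "induced_metric (L_dom I) (L_map w) (x, s) (u, a) (v, b)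
        = (cmod (w s))\<^sup>2 * (u \<bullet> v) + (cmod (w' s))\<^sup>2 * (a * b)"
      unfolding induced_metric_def d[OF uv(1)] d[OF uv(2)]
      by (simp add: inner_add inner_scale_vec uv xx inner_commute[of x v] power2_norm_eq_inner)
  qed (use I w w' w'' w'_smooth in \<open>auto intro!: sq sq_smooth\<close>)
  then show ?thesis by blast
qed

theorem theorem2p2:
  fixes I :: "real set" and w w' :: "real \<Rightarrow> complex" and a :: "real \<Rightarrow> real"
  assumes "is_interval I" and "\<exists>u\<in>I. \<exists>v\<in>I. u < v"
    and "smooth_on I w" and "\<And>s. s \<in> I \<Longrightarrow> w s \<noteq> 0"
    and "\<And>s. s \<in> I \<Longrightarrow> w' s = vector_derivative w (at s within I)"
    and "\<And>s. s \<in> I \<Longrightarrow> w' s \<noteq> 0"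
    and "\<And>s. s \<in> I \<Longrightarrow>
      a s = - ((real CARD('n::finite) - 1) * Re (cnj (w s) * w' s)) / ((cmod (w s))\<^sup>2 * (cmod (w' s))\<^sup>2)"
  shows "(\<forall>s\<in>I. \<forall>x\<in>sphere (0::real ^ 'n) 1.
            leaf_mean_curvature w I s x = a s *\<^sub>R L_partial_s w I x s \<and>
            L_partial_s w I x s = (\<chi> j. complex_of_real (x $ j) * w' s) \<and>
            L_partial_s w I x s \<in> L_tangent w I x s) \<and>
         (\<forall>J f. is_interval J \<and> f ` J \<subseteq> I \<and>
            (\<forall>t\<in>J. (f has_real_derivative a (f t)) (at t within J)) \<longrightarrow>
            leaves_mean_curvature_flow TYPE('n) w I J f)"
proof -
  note I = assms(1,2)
  have w': "(w has_vector_derivative w' s) (at s within I)" if "s \<in> I" for s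
    using smooth_on_differentiable[OF assms(3) that] assms(5)[OF that]
    by (simp add: vector_derivative_works[symmetric])
  obtain C' where "warped_cylinder I (\<lambda>s. (cmod (w s))\<^sup>2) (\<lambda>s. 2 * (w s \<bullet> w' s))
      (\<lambda>s. (cmod (w' s))\<^sup>2) C' (induced_metric (L_dom I) (L_map w :: (real ^ 'n) \<times> real \<Rightarrow> _))"
    using warped_cylinder_induced_metric[OF I assms(3,4) w' assms(6)] by blast
  then interpret warped_cylinder I "\<lambda>s. (cmod (w s))\<^sup>2" "\<lambda>s. 2 * (w s \<bullet> w' s)"
    "\<lambda>s. (cmod (w' s))\<^sup>2" C' "induced_metric (L_dom I) (L_map w :: (real ^ 'n) \<times> real \<Rightarrow> _)" .
  have dL: "differential (L_dom I) (L_map w) (x, s) (0, c) = c *\<^sub>R scale_vec x (w' s)"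
    and tan: "(0, c) \<in> tangent_space (L_dom I) (x, s)"
    if "s \<in> I" "norm x = 1" for s c and x :: "real ^ 'n"
  proof -
    show tan: "(0, c) \<in> tangent_space (L_dom I) (x, s)"
      by (simp add: tangent_space_L_dom[OF I that(2,1)])
    show "differential (L_dom I) (L_map w) (x, s) (0, c) = c *\<^sub>R scale_vec x (w' s)"
      using differential_eq[OF L_map_has_derivative[OF w'[OF that(1)]] tan]
      by (simp add: bounded_bilinear.scaleR_right[OF bounded_bilinear_scale_vec]
          bounded_bilinear.zero_left[OF bounded_bilinear_scale_vec])
  qed
  have a: "a s = - ((real CARD('n) - 1) * (w s \<bullet> w' s)) / ((cmod (w s))\<^sup>2 * (cmod (w' s))\<^sup>2)"
    if "s \<in> I" for s
    unfolding assms(7)[OF that] by (simp add: inner_complex_def)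
  have H: "leaf_mean_curvature w I s x = a s *\<^sub>R scale_vec x (w' s)"
    if "s \<in> I" "norm x = 1" for s and x :: "real ^ 'n"
    unfolding leaf_mean_curvature_def mean_curvature_slice[OF that(2,1)] dL[OF that]
    by (simp add: a[OF that(1)])
  have flow: "((\<lambda>\<tau>. L_map w (x, f \<tau>)) has_vector_derivative leaf_mean_curvature w I (f t) x)
      (at t within J)"
    if f: "f ` J \<subseteq> I" "(f has_real_derivative a (f t)) (at t within J)" and "t \<in> J" "norm x = 1"
    for J f t and x :: "real ^ 'n"
  proof -
    have ft: "f t \<in> I" using that by auto
    have "(w has_vector_derivative w' (f t)) (at (f t) within f ` J)"
      by (rule has_vector_derivative_within_subset[OF w'[OF ft] f(1)])
    from vector_diff_chain_within[OF f(2)[unfolded has_real_derivative_iff_has_vector_derivative] this]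
    have "((\<lambda>\<tau>. w (f \<tau>)) has_vector_derivative a (f t) *\<^sub>R w' (f t)) (at t within J)"
      by (simp add: o_def)
    from bounded_linear.has_vector_derivative[OF
        bounded_bilinear.bounded_linear_right[OF bounded_bilinear_scale_vec] this, of x]
    show ?thesis
      unfolding H[OF ft \<open>norm x = 1\<close>] L_map_eq
      by (simp add: bounded_bilinear.scaleR_right[OF bounded_bilinear_scale_vec])
  qed
  have partial: "L_partial_s w I x s = scale_vec x (w' s)" "L_partial_s w I x s \<in> L_tangent w I x s"
    if "s \<in> I" "norm x = 1" for s and x :: "real ^ 'n"
    using dL[OF that] tan[OF that] by (auto simp: L_partial_s_def L_tangent_def intro!: image_eqI[of _ _ "(0, 1)"])
  show ?thesis
    using H partial flow unfolding leaves_mean_curvature_flow_def scale_vec_def by simp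
qed

end
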